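(* Let $\alpha$ be the size of the alphabet of the matrix entries and let $c_t:=\frac83(t+1)^2 2^{4t}$. Then (1) every $t$-twin-ordered matrix is $(2t+2)$-mixed free; and (2) every $t$-mixed free matrix has twin-width at most $4c_t\alpha^{4c_t+2}=2^{2^{O(t)}}$.
   Context: Matrices are finite with entries from a finite alphabet of size $\alpha$. For an $n\times m$ matrix $M$, a partition of $M$ is a pair $(\mathcal R,\mathcal C)$ of a partition $\mathcal R$ of its rows and a partition $\mathcal C$ of its columns; a zone is $R\cap C$ (the submatrix on rows of $R\in\mathcal R$ and columns of $C\in\mathcal C$). A zone is constant if all its entries are equal. The error value of a part $R\in\mathcal R$ is the number of $C\in\mathcal C$ with $R\cap C$ non-constant, similarly for $C\in\mathcal C$; the error value of $(\mathcal R,\mathcal C)$ is the maximum over all parts. A contraction sequence of $M$ is a sequence of partitions $(\mathcal R^1,\mathcal C^1),\ldots,(\mathcal R^{n+m-1},\mathcal C^{n+m-1})$ where the first is the partition into singletons, the last has one row part and one column part, and each is obtained from the previous by merging two parts of the row partition or two parts of the column partition. The twin-width of $M$ is the minimum $t$ such that some contraction sequence has all error values at most $t$. A division is a partition whose parts consist of consecutive rows (resp. consecutive columns); a $(k,\ell)$-division has $k$ row parts and $\ell$ column parts. $M$ is $t$-twin-ordered if it has a contraction sequence in which every partition is a division and every error value is at most $t$. A matrix $(m_{i,j})$ is vertical if $m_{i,j}=m_{i+1,j}$ for all $i,j$, horizontal if $m_{i,j}=m_{i,j+1}$ for all $i,j$, and mixed if it is neither. A $t$-mixed minor is a $(t,t)$-division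 in which every zone is mixed; $M$ is $t$-mixed free if it has no $t$-mixed minor. *)

theory Defs
  imports
    "Jordan_Normal_Form.DL_Submatrix"
    "HOL-Library.Disjoint_Sets"
    "HOL-Library.Landau_Symbols"
begin

text \<open>Rows and columns are numbered from 0, as in the matrix library. Entries outside the
  dimensions of a matrix are never inspected.\<close>

definition constant_mat :: "'a mat \<Rightarrow> bool" where
  "constant_mat M \<longleftrightarrow>
    (\<forall>i<dim_row M. \<forall>j<dim_col M. \<forall>i'<dim_row M. \<forall>j'<dim_col M. M $$ (i, j) = M $$ (i', j'))"

definition vertical_mat :: "'a mat \<Rightarrow> bool" where
  "vertical_mat M \<longleftrightarrow>
    (\<forall>i j. Suc i < dim_row M \<longrightarrow> j < dim_col M \<longrightarrow> M $$ (i, j) = M $$ (Suc i, j))"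

definition horizontal_mat :: "'a mat \<Rightarrow> bool" where
  "horizontal_mat M \<longleftrightarrow>
    (\<forall>i j. i < dim_row M \<longrightarrow> Suc j < dim_col M \<longrightarrow> M $$ (i, j) = M $$ (i, Suc j))"

definition mixed_mat :: "'a mat \<Rightarrow> bool" where
  "mixed_mat M \<longleftrightarrow> \<not> vertical_mat M \<and> \<not> horizontal_mat M"

type_synonym mat_part = "nat set set \<times> nat set set"

definition mat_partition :: "'a mat \<Rightarrow> mat_part \<Rightarrow> bool" where
  "mat_partition M P \<longleftrightarrow>
    partition_on {..<dim_row M} (fst P) \<and> partition_on {..<dim_col M} (snd P)"

text \<open>The zone of a row part \<open>X\<close> and a column part \<open>Y\<close> is \<open>submatrix M X Y\<close>.\<close>

definition row_error :: "'a mat \<Rightarrow> mat_part \<Rightarrow> nat set \<Rightarrow> nat" where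
  "row_error M P X = card {Y \<in> snd P. \<not> constant_mat (submatrix M X Y)}"

definition col_error :: "'a mat \<Rightarrow> mat_part \<Rightarrow> nat set \<Rightarrow> nat" where
  "col_error M P Y = card {X \<in> fst P. \<not> constant_mat (submatrix M X Y)}"

definition error_value :: "'a mat \<Rightarrow> mat_part \<Rightarrow> nat" where
  "error_value M P = Max (row_error M P ` fst P \<union> col_error M P ` snd P)"

definition merge_two :: "nat set set \<Rightarrow> nat set set \<Rightarrow> bool" where
  "merge_two P Q \<longleftrightarrow> (\<exists>X\<in>P. \<exists>Y\<in>P. X \<noteq> Y \<and> Q = insert (X \<union> Y) (P - {X, Y}))"

definition contraction_step :: "mat_part \<Rightarrow> mat_part \<Rightarrow> bool" where
  "contraction_step P Q \<longleftrightarrow>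
    merge_two (fst P) (fst Q) \<and> snd Q = snd P \<or> fst Q = fst P \<and> merge_two (snd P) (snd Q)"

text \<open>The sequence is 0-indexed: its members are \<open>Ps ! 0, \<dots>, Ps ! (n + m - 2)\<close> for an
  \<open>n \<times> m\<close> matrix. Such a sequence exists only if \<open>n\<close> and \<open>m\<close> are positive.\<close>

definition contraction_sequence :: "'a mat \<Rightarrow> mat_part list \<Rightarrow> bool" where
  "contraction_sequence M Ps \<longleftrightarrow>
    length Ps = dim_row M + dim_col M - 1 \<and>
    Ps \<noteq> [] \<and>
    (\<forall>P\<in>set Ps. mat_partition M P) \<and>
    hd Ps = ((\<lambda>i. {i}) ` {..<dim_row M}, (\<lambda>j. {j}) ` {..<dim_col M}) \<and>
    card (fst (last Ps)) = 1 \<and> card (snd (last Ps)) = 1 \<and>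
    (\<forall>i. Suc i < length Ps \<longrightarrow> contraction_step (Ps ! i) (Ps ! Suc i))"

text \<open>The minimum is over a nonempty set of numbers whenever \<open>M\<close> has at least one row and one
  column; otherwise \<open>twin_width M\<close> is unspecified.\<close>

definition twin_width :: "'a mat \<Rightarrow> nat" where
  "twin_width M =
    (LEAST t. \<exists>Ps. contraction_sequence M Ps \<and> (\<forall>P\<in>set Ps. error_value M P \<le> t))"

definition mat_division :: "'a mat \<Rightarrow> mat_part \<Rightarrow> bool" where
  "mat_division M P \<longleftrightarrow>
    mat_partition M P \<and> (\<forall>X \<in> fst P \<union> snd P. \<exists>a b. X = {a..<b})"

definition kl_division :: "nat \<Rightarrow> nat \<Rightarrow> 'a mat \<Rightarrow> mat_part \<Rightarrow> bool" where
  "kl_division k l M P \<longleftrightarrow> mat_division M P \<and> card (fst P) = k \<and> card (snd P) = l"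

definition twin_ordered :: "nat \<Rightarrow> 'a mat \<Rightarrow> bool" where
  "twin_ordered t M \<longleftrightarrow>
    (\<exists>Ps. contraction_sequence M Ps \<and> (\<forall>P\<in>set Ps. mat_division M P \<and> error_value M P \<le> t))"

definition mixed_minor :: "nat \<Rightarrow> 'a mat \<Rightarrow> mat_part \<Rightarrow> bool" where
  "mixed_minor t M P \<longleftrightarrow>
    kl_division t t M P \<and> (\<forall>X\<in>fst P. \<forall>Y\<in>snd P. mixed_mat (submatrix M X Y))"

definition mixed_free :: "nat \<Rightarrow> 'a mat \<Rightarrow> bool" where
  "mixed_free t M \<longleftrightarrow> \<not> (\<exists>P. mixed_minor t M P)"

definition c_const :: "nat \<Rightarrow> real" where
  "c_const t = 8 / 3 * (real t + 1)^2 * 2 ^ (4 * t)"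

end

(* A corner is a mixed contiguous 2 x 2 submatrix; a contiguous zone is mixed iff it contains a corner.

   (1) Follow the sequence of divisions until a part first contains a part of a mixed minor. Only one
   side changes in a step, so if it is a row part R, every column part of the minor is still cut; R is
   nonconstant over all 2t+2 of them, and a part of the division meets at most two of them.

   (2) Merge consecutive parts greedily, keeping the number of mixed zones and mixed cuts of each part
   below about 2 c_t. If no merge is possible, the corners of the pairs of consecutive parts form a dense
   0-1 matrix, and a Marcus-Tardos bound yields a t-mixed minor. The bound below is proved by halving the
   columns as Fox does, but counting ones instead of wide rows; this gives 2^(3t) instead of 2^(4t) up
   to polynomial factors and leaves room for all constants. Inside a row part, rows which agree on the
   non-mixed zones are put together; there are at most alpha^(K+1) classes, since the non-mixed zones
   form at most K+1 runs on each of which a row is constant or equal to the other rows. The refined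
   partitions have only constant zones outside the mixed ones, so that they bound the error. *)

theory Submission
  imports Defs
begin

section \<open>A Marcus-Tardos bound for grid minors\<close>

text \<open>The labels of consecutive parts only steer the construction; the contraction sequence
  runs through their refinements. Merging labels can only create mixed zones and so drops
  comparisons between rows. Hence the old refinement refines the new one, and every order of
  pairwise merges between the two is allowed. One merge of labels joins at most two old parts, so
  each of the at most K mixed zones of a part is cut into at most 2 \<alpha>^(K+1) refined ones;
  this is the error 2 K \<alpha>^(K+1). Mixed values have to count cuts as well: a corner across the
  border of two column parts may leave both zones unmixed, yet it breaks the runs along which rows
  are compared. The price is that dense labels may come from corners lying in no zone. Pairing
  neighbouring column labels by parity makes room for them and doubles the Marcus-Tardos bound, so
  that at most 32 k 8^k p / 3 pairs of labels occur for p parts. Since p parts give p div 2 \<ge> p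
  / 3 disjoint pairs, any K \<ge> 32 k 8^k is enough. The floor of 2 c_k qualifies, and the exponent
  K + 1 \<le> 2 c_k + 1 lies within the stated one.\<close>

text \<open>The fibres of \<open>\<rho>\<close> and \<open>\<chi>\<close> are the row and column parts of the minor; values beyond \<open>k\<close>
  and \<open>l\<close> are harmless, since the last part can absorb them.\<close>

definition grid_minor :: "nat \<Rightarrow> nat \<Rightarrow> (nat \<times> nat) set \<Rightarrow> bool" where
  "grid_minor k l E \<longleftrightarrow>
    (\<exists>\<rho> \<chi> :: nat \<Rightarrow> nat. mono \<rho> \<and> mono \<chi> \<and> {..<k} \<times> {..<l} \<subseteq> map_prod \<rho> \<chi> ` E)"

lemma grid_minor_mono: "grid_minor k l E \<Longrightarrow> E \<subseteq> F \<Longrightarrow> grid_minor k l F"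
  unfolding grid_minor_def by (meson image_mono order_trans)

text \<open>The part maps are pulled back along the contraction. So blocks of rows or columns can be
  collapsed to single indices without creating a minor.\<close>

lemma grid_minor_image:
  assumes "grid_minor k l (map_prod g h ` E)" "mono g" "mono h"
  shows "grid_minor k l E"
proof -
  obtain \<rho> \<chi> :: "nat \<Rightarrow> nat" where "mono \<rho>" "mono \<chi>"
    and *: "{..<k} \<times> {..<l} \<subseteq> map_prod \<rho> \<chi> ` map_prod g h ` E"
    using assms unfolding grid_minor_def by blast
  have "mono (\<rho> \<circ> g)" "mono (\<chi> \<circ> h)"
    using \<open>mono \<rho>\<close> \<open>mono \<chi>\<close> assms by (simp_all add: monotone_on_def)
  moreover have "{..<k} \<times> {..<l} \<subseteq> map_prod (\<rho> \<circ> g) (\<chi> \<circ> h) ` E"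
    using * by (simp add: image_image map_prod_def split_def)
  ultimately show ?thesis unfolding grid_minor_def by blast
qed

lemma grid_minor_converse: "grid_minor k l (E\<inverse>) \<Longrightarrow> grid_minor l k E"
  unfolding grid_minor_def
proof (elim exE conjE)
  fix \<rho> \<chi> :: "nat \<Rightarrow> nat"
  assume m: "mono \<rho>" "mono \<chi>" and *: "{..<k} \<times> {..<l} \<subseteq> map_prod \<rho> \<chi> ` (E\<inverse>)"
  have "{..<l} \<times> {..<k} \<subseteq> map_prod \<chi> \<rho> ` E"
  proof
    fix z assume "z \<in> {..<l} \<times> {..<k}"
    then obtain i j where z: "z = (j, i)" and "(i, j) \<in> {..<k} \<times> {..<l}" by auto
    then have "(i, j) \<in> map_prod \<rho> \<chi> ` (E\<inverse>)" using * by blast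
    then show "z \<in> map_prod \<chi> \<rho> ` E" unfolding z by force
  qed
  then show "\<exists>\<rho> \<chi> :: nat \<Rightarrow> nat. mono \<rho> \<and> mono \<chi> \<and> {..<l} \<times> {..<k} \<subseteq> map_prod \<rho> \<chi> ` E"
    using m by blast
qed

text \<open>Ranking the occupied rows gives the row map. This is the case of a single column part,
  where the induction on the width stops.\<close>

lemma grid_minor_single_column:
  assumes "finite E" "k \<le> card (fst ` E)"
  shows "grid_minor k 1 E"
proof -
  define \<rho> where "\<rho> x = card {x' \<in> fst ` E. x' < x}" for x
  have fin: "finite (fst ` E)" using assms(1) by simp
  have "mono \<rho>"
    unfolding \<rho>_def mono_def using fin by (auto intro!: card_mono)
  have inj: "inj_on \<rho> (fst ` E)"
  proof (rule linorder_inj_onI)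
    fix x y assume "x < y" "x \<in> fst ` E" "y \<in> fst ` E"
    then have "{x' \<in> fst ` E. x' < x} \<subset> {x' \<in> fst ` E. x' < y}" by (force simp: psubset_eq)
    then have "\<rho> x < \<rho> y" unfolding \<rho>_def using fin by (intro psubset_card_mono) auto
    then show "\<rho> x \<noteq> \<rho> y" by simp
  qed auto
  have sub: "\<rho> ` fst ` E \<subseteq> {..<card (fst ` E)}"
  proof
    fix z assume "z \<in> \<rho> ` fst ` E"
    then obtain x where x: "x \<in> fst ` E" "z = \<rho> x" by blast
    then have "{x' \<in> fst ` E. x' < x} \<subset> fst ` E" by blast
    then show "z \<in> {..<card (fst ` E)}"
      unfolding x \<rho>_def using psubset_card_mono[OF fin] by simp
  qed
  have "card (\<rho> ` fst ` E) = card (fst ` E)" using inj by (rule card_image)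
  then have "\<rho> ` fst ` E = {..<card (fst ` E)}"
    using sub by (simp add: card_subset_eq)
  then have sur: "{..<k} \<subseteq> \<rho> ` fst ` E" using assms(2) by simp
  have "{..<k} \<times> {..<1} \<subseteq> map_prod \<rho> (\<lambda>_. 0::nat) ` E"
  proof
    fix z :: "nat \<times> nat" assume "z \<in> {..<k} \<times> {..<1}"
    then obtain p where "p \<in> E" "z = (\<rho> (fst p), 0)"
      using sur by fastforce
    then have "z = map_prod \<rho> (\<lambda>_. 0) p" by (cases p) simp
    then show "z \<in> map_prod \<rho> (\<lambda>_. 0) ` E" using \<open>p \<in> E\<close> by blast
  qed
  moreover have "mono (\<lambda>_::nat. 0::nat)" by (simp add: mono_def)
  ultimately show ?thesis using \<open>mono \<rho>\<close> unfolding grid_minor_def by blast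
qed

text \<open>The entries from column \<open>h\<close> on form a new last column part. Every row part
  already contains an entry, as 1 \<le> l, and the row of that entry continues beyond
  \<open>h\<close>.\<close>

lemma grid_minor_extend:
  assumes minor: "grid_minor k l {(x, y) \<in> E. y < h \<and> (\<exists>y'\<ge>h. (x, y') \<in> E)}" and "1 \<le> l"
  shows "grid_minor k (Suc l) E"
proof -
  obtain \<rho> \<chi> :: "nat \<Rightarrow> nat" where m: "mono \<rho>" "mono \<chi>"
    and *: "{..<k} \<times> {..<l} \<subseteq> map_prod \<rho> \<chi> ` {(x, y) \<in> E. y < h \<and> (\<exists>y'\<ge>h. (x, y') \<in> E)}"
    using minor unfolding grid_minor_def by blast
  \<comment> \<open>Values of \<open>\<chi>\<close> above \<open>l - 1\<close> are cut down, as they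
    could exceed the label \<open>l\<close> of the new part and spoil monotonicity.\<close>
  define \<chi>' where "\<chi>' y = (if y < h then min (\<chi> y) (l - 1) else l)" for y
  have "mono \<chi>'"
    unfolding mono_def
  proof (intro allI impI)
    fix a b :: nat assume "a \<le> b"
    then have "\<chi> a \<le> \<chi> b" using m by (simp add: monoD)
    then show "\<chi>' a \<le> \<chi>' b" using \<open>a \<le> b\<close> by (auto simp: \<chi>'_def min_def)
  qed
  have "(i, j) \<in> map_prod \<rho> \<chi>' ` E" if i: "i < k" and j: "j < Suc l" for i j
  proof (cases "j < l")
    case True
    then obtain x y where "(x, y) \<in> E" "y < h" "\<rho> x = i" "\<chi> y = j" using * i by blast
    then have "(i, j) = map_prod \<rho> \<chi>' (x, y)" using True by (simp add: \<chi>'_def)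
    then show ?thesis using \<open>(x, y) \<in> E\<close> by blast
  next
    case False
    then have "j = l" using j by simp
    have "(i, 0) \<in> {..<k} \<times> {..<l}" using i \<open>1 \<le> l\<close> by simp
    then obtain x y' where "(x, y') \<in> E" "y' \<ge> h" "\<rho> x = i" using * by blast
    then have "(i, j) = map_prod \<rho> \<chi>' (x, y')" using \<open>j = l\<close> by (simp add: \<chi>'_def)
    then show ?thesis using \<open>(x, y') \<in> E\<close> by blast
  qed
  then have "{..<k} \<times> {..<Suc l} \<subseteq> map_prod \<rho> \<chi>' ` E" by auto
  then show ?thesis using m \<open>mono \<chi>'\<close> unfolding grid_minor_def by blast
qed

lemma grid_minor_extend_left:
  assumes minor: "grid_minor k l {(x, y) \<in> E. h \<le> y \<and> (\<exists>y'<h. (x, y') \<in> E)}" and "1 \<le> l"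
  shows "grid_minor k (Suc l) E"
proof -
  obtain \<rho> \<chi> :: "nat \<Rightarrow> nat" where m: "mono \<rho>" "mono \<chi>"
    and *: "{..<k} \<times> {..<l} \<subseteq> map_prod \<rho> \<chi> ` {(x, y) \<in> E. h \<le> y \<and> (\<exists>y'<h. (x, y') \<in> E)}"
    using minor unfolding grid_minor_def by blast
  define \<chi>' where "\<chi>' y = (if y < h then 0 else Suc (\<chi> y))" for y
  have "mono \<chi>'"
    unfolding mono_def
  proof (intro allI impI)
    fix a b :: nat assume "a \<le> b"
    then have "\<chi> a \<le> \<chi> b" using m by (simp add: monoD)
    then show "\<chi>' a \<le> \<chi>' b" using \<open>a \<le> b\<close> by (auto simp: \<chi>'_def min_def)
  qed
  have "(i, j) \<in> map_prod \<rho> \<chi>' ` E" if i: "i < k" and j: "j < Suc l" for i j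
  proof (cases j)
    case (Suc j')
    then have "j' < l" using j by simp
    then obtain x y where "(x, y) \<in> E" "h \<le> y" "\<rho> x = i" "\<chi> y = j'" using * i by blast
    then have "(i, j) = map_prod \<rho> \<chi>' (x, y)" using Suc by (simp add: \<chi>'_def)
    then show ?thesis using \<open>(x, y) \<in> E\<close> by blast
  next
    case 0
    have "(i, 0) \<in> {..<k} \<times> {..<l}" using i \<open>1 \<le> l\<close> by simp
    then obtain x y' where "(x, y') \<in> E" "y' < h" "\<rho> x = i" using * by blast
    then have "(i, j) = map_prod \<rho> \<chi>' (x, y')" using 0 by (simp add: \<chi>'_def)
    then show ?thesis using \<open>(x, y') \<in> E\<close> by blast
  qed
  then have "{..<k} \<times> {..<Suc l} \<subseteq> map_prod \<rho> \<chi>' ` E" by auto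
  then show ?thesis using m \<open>mono \<chi>'\<close> unfolding grid_minor_def by blast
qed

text \<open>The rows with ones in both halves of the columns have no \<open>(k, l)\<close> minor in either half, as the
  other half would supply the missing column part. They are counted twice, whence \<open>2 ^ l\<close>.\<close>

lemma card_narrow_no_grid_minor:
  assumes "finite E" "snd ` E \<subseteq> {c..<c + 2 ^ a}" "\<not> grid_minor k (Suc l) E"
  shows "card E \<le> 2 ^ l * card (fst ` E) + (k - 1) * 2 ^ a * (a choose l)"
  using assms
proof (induction a arbitrary: E c l)
  case 0
  have "inj_on fst E"
  proof (rule inj_onI)
    fix p q assume "p \<in> E" "q \<in> E" "fst p = fst q"
    moreover have "snd p = c" "snd q = c" using 0(2) \<open>p \<in> E\<close> \<open>q \<in> E\<close> by auto
    ultimately show "p = q" by (simp add: prod_eq_iff)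
  qed
  then have "card E = card (fst ` E)" by (simp add: card_image)
  also have "\<dots> \<le> 2 ^ l * card (fst ` E)" by simp
  finally show ?case by simp
next
  case (Suc a)
  show ?case
  proof (cases l)
    case 0
    then have "\<not> k \<le> card (fst ` E)" using grid_minor_single_column Suc.prems by auto
    then have "card (fst ` E) \<le> k - 1" by simp
    have "E \<subseteq> fst ` E \<times> {c..<c + 2 ^ Suc a}" using Suc.prems(2) by force
    then have "card E \<le> card (fst ` E \<times> {c..<c + 2 ^ Suc a})"
      using Suc.prems(1) by (intro card_mono) auto
    also have "\<dots> = card (fst ` E) * 2 ^ Suc a" by (simp add: card_cartesian_product)
    also have "\<dots> \<le> (k - 1) * 2 ^ Suc a" using \<open>card (fst ` E) \<le> k - 1\<close> by (rule mult_le_mono1)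
    finally show ?thesis using 0 by simp
  next
    case (Suc l')
    define K where "K = k - 1"
    define h where "h = c + 2 ^ a"
    define BL where "BL = {(x, y) \<in> E. y < h \<and> (\<exists>y'\<ge>h. (x, y') \<in> E)}"
    define BR where "BR = {(x, y) \<in> E. h \<le> y \<and> (\<exists>y'<h. (x, y') \<in> E)}"
    define L where "L = {(x, y) \<in> E. y < h} - BL"
    define R where "R = {(x, y) \<in> E. h \<le> y} - BR"
    have sub: "BL \<subseteq> E" "BR \<subseteq> E" "L \<subseteq> E" "R \<subseteq> E"
      unfolding BL_def BR_def L_def R_def by auto
    then have fin: "finite BL" "finite BR" "finite L" "finite R"
      using Suc.prems(1) finite_subset by blast+
    have hc: "c + 2 ^ Suc a = h + 2 ^ a" by (simp add: h_def)
    have cols: "snd ` L \<subseteq> {c..<c + 2 ^ a}" "snd ` BL \<subseteq> {c..<c + 2 ^ a}"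
      "snd ` R \<subseteq> {h..<h + 2 ^ a}" "snd ` BR \<subseteq> {h..<h + 2 ^ a}"
      using Suc.prems(2) unfolding hc h_def[symmetric] BL_def BR_def L_def R_def by force+
    have nm: "\<not> grid_minor k (Suc l) L" "\<not> grid_minor k (Suc l) R"
      using Suc.prems(3) sub grid_minor_mono by blast+
    have nmB: "\<not> grid_minor k (Suc l') BL" "\<not> grid_minor k (Suc l') BR"
      using Suc.prems(3) grid_minor_extend[of k "Suc l'" E h]
        grid_minor_extend_left[of k "Suc l'" E h] unfolding BL_def BR_def Suc by auto
    have eqB: "fst ` BL = fst ` BR" unfolding BL_def BR_def by force
    have "E = BL \<union> BR \<union> (L \<union> R)" unfolding BL_def BR_def L_def R_def by auto
    then have "card E \<le> card BL + card BR + (card L + card R)"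
      using card_Un_le[of "BL \<union> BR" "L \<union> R"] card_Un_le[of BL BR] card_Un_le[of L R] by simp
    moreover have "card L \<le> 2 ^ l * card (fst ` L) + K * 2 ^ a * (a choose l)"
      unfolding K_def by (rule Suc.IH[OF fin(3) cols(1) nm(1)])
    moreover have "card R \<le> 2 ^ l * card (fst ` R) + K * 2 ^ a * (a choose l)"
      unfolding K_def by (rule Suc.IH[OF fin(4) cols(3) nm(2)])
    moreover have "card BL \<le> 2 ^ l' * card (fst ` BL) + K * 2 ^ a * (a choose l')"
      unfolding K_def by (rule Suc.IH[OF fin(1) cols(2) nmB(1)])
    moreover have "card BR \<le> 2 ^ l' * card (fst ` BL) + K * 2 ^ a * (a choose l')"
      unfolding K_def eqB by (rule Suc.IH[OF fin(2) cols(4) nmB(2)])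
    ultimately have 1: "card E \<le> 2 ^ l * (card (fst ` L) + card (fst ` R) + card (fst ` BL)) +
        K * 2 ^ Suc a * ((a choose l) + (a choose l'))"
      unfolding Suc by (simp add: algebra_simps)
    \<comment> \<open>The rows meeting only the left half, only the right half, or both are
      disjoint, so the row terms add up to at most that of \<open>E\<close>. The remaining terms
      combine by Pascal's rule.\<close>
    have d: "fst ` L \<inter> fst ` R = {}" "(fst ` L \<union> fst ` R) \<inter> fst ` BL = {}"
      unfolding L_def R_def BL_def BR_def by auto
    have "card (fst ` L) + card (fst ` R) + card (fst ` BL) = card (fst ` L \<union> fst ` R \<union> fst ` BL)"
      using d fin by (simp add: card_Un_disjoint)
    also have "\<dots> \<le> card (fst ` E)"
      using Suc.prems(1) sub by (intro card_mono) auto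
    finally have "2 ^ l * (card (fst ` L) + card (fst ` R) + card (fst ` BL)) \<le> 2 ^ l * card (fst ` E)"
      by simp
    moreover have "(a choose l) + (a choose l') = (Suc a choose l)" unfolding Suc by simp
    ultimately show ?thesis using 1 unfolding K_def[symmetric] by (metis add_le_mono1 order_trans)
  qed
qed

text \<open>Each block of \<open>2 ^ a\<close> columns is narrow. Summed over the nonempty blocks,
  the numbers of occupied rows count exactly the entries of the contracted set, and the remainder is
  paid once per nonempty block.\<close>

lemma card_contract_columns:
  fixes a :: nat
  assumes "finite E" "\<not> grid_minor k (Suc l) E"
  defines "F \<equiv> map_prod id (\<lambda>y. y div 2 ^ a) ` E"
  shows "card E \<le> 2 ^ l * card F + (k - 1) * 2 ^ a * (a choose l) * card (snd ` F)"
proof -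
  define t :: nat where "t = 2 ^ a"
  define C where "C q = {(x, y) \<in> E. y div t = q}" for q
  have finC: "finite (C q)" for q
    unfolding C_def using assms(1) by (rule rev_finite_subset) auto
  have "finite F" unfolding F_def using assms(1) by simp
  have "t > 0" by (simp add: t_def)
  have "E = (\<Union>q \<in> snd ` F. C q)" unfolding F_def C_def t_def by force
  then have "card E = (\<Sum>q \<in> snd ` F. card (C q))"
    using \<open>finite F\<close> finC
    by (subst card_UN_disjoint[symmetric]) (auto simp: C_def)
  also have "\<dots> \<le> (\<Sum>q \<in> snd ` F. 2 ^ l * card (fst ` C q) + (k - 1) * t * (a choose l))"
  proof (rule sum_mono)
    fix q
    have "snd ` C q \<subseteq> {q * t..<q * t + 2 ^ a}"
    proof
      fix y assume "y \<in> snd ` C q"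
      then have "y div t = q" unfolding C_def by auto
      then have "q * t \<le> y" "y < q * t + t"
        using \<open>t > 0\<close> div_mult_mod_eq[of y t] mod_less_divisor[of t y] by (auto, linarith)
      then show "y \<in> {q * t..<q * t + 2 ^ a}" by (simp add: t_def)
    qed
    moreover have "\<not> grid_minor k (Suc l) (C q)"
      using assms(2) grid_minor_mono[of k "Suc l" "C q" E] unfolding C_def by auto
    ultimately show "card (C q) \<le> 2 ^ l * card (fst ` C q) + (k - 1) * t * (a choose l)"
      unfolding t_def using card_narrow_no_grid_minor finC by blast
  qed
  also have "\<dots> = 2 ^ l * (\<Sum>q \<in> snd ` F. card (fst ` C q)) + (k - 1) * t * (a choose l) * card (snd ` F)"
    by (simp add: sum.distrib sum_distrib_left mult.commute)
  also have "(\<Sum>q \<in> snd ` F. card (fst ` C q)) = card F"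
  proof -
    have "F = (\<Union>q \<in> snd ` F. (\<lambda>x. (x, q)) ` fst ` C q)"
      unfolding F_def C_def t_def by force
    moreover have "card (\<Union>q \<in> snd ` F. (\<lambda>x. (x, q)) ` fst ` C q) =
        (\<Sum>q \<in> snd ` F. card ((\<lambda>x. (x, q)) ` fst ` C q))"
      using \<open>finite F\<close> finC by (intro card_UN_disjoint) auto
    moreover have "card ((\<lambda>x. (x, q)) ` fst ` C q) = card (fst ` C q)" for q
      by (intro card_image inj_onI) simp
    ultimately show ?thesis by simp
  qed
  finally show ?thesis by (simp add: t_def)
qed

lemma card_contract_rows:
  fixes a :: nat
  assumes "finite E" "\<not> grid_minor (Suc l) k E"
  defines "F \<equiv> map_prod (\<lambda>x. x div 2 ^ a) id ` E"
  shows "card E \<le> 2 ^ l * card F + (k - 1) * 2 ^ a * (a choose l) * card (fst ` F)"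
proof -
  have "\<not> grid_minor k (Suc l) (E\<inverse>)" using assms(2) grid_minor_converse by blast
  moreover have "map_prod id (\<lambda>y. y div 2 ^ a) ` (E\<inverse>) = F\<inverse>" unfolding F_def by force
  moreover have "snd ` (F\<inverse>) = fst ` F" by force
  ultimately show ?thesis
    using card_contract_columns[of "E\<inverse>" k l a] assms(1) by simp
qed

text \<open>Contracting columns and then rows in blocks of length \<open>t\<close> leads to a square
  of side about N / t. Each contraction costs a factor S = 2^(k-1), so t = 8 S^2 leaves 1/8, and
  rounding N / t up at most doubles this. A quarter of the bound thus pays for the recursion and
  three quarters pay for the remainders.\<close>

theorem card_no_grid_minor:
  assumes "E \<subseteq> {..<N} \<times> {..<N}" "\<not> grid_minor k k E" "1 \<le> k"
  shows "3 * card E \<le> 16 * k * 8 ^ k * N"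
  using assms(1,2)
proof (induction N arbitrary: E rule: less_induct)
  case (less N)
  obtain l where k: "k = Suc l" using \<open>1 \<le> k\<close> by (cases k) auto
  define S :: nat where "S = 2 ^ l"
  define a where "a = 2 * l + 3"
  define t :: nat where "t = 2 ^ a"
  define f where "f = l * (a choose l)"
  have t: "t = 8 * (S * S)"
  proof -
    have "t = 2 ^ l * 2 ^ l * 2 ^ 3" unfolding t_def a_def mult_2 power_add by (rule refl)
    then show ?thesis unfolding S_def by simp
  qed
  have S8: "8 ^ k = 8 * (S * (S * S))"
  proof -
    have "(8::nat) ^ l = (2 * (2 * 2)) ^ l" by simp
    also have "\<dots> = S * (S * S)" unfolding S_def power_mult_distrib by simp
    finally show ?thesis unfolding k by simp
  qed
  have "S \<ge> 1" by (simp add: S_def)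
  then have SS: "S * S \<le> S * (S * S)" by (metis le_square mult_le_mono2)
  have finE: "finite E" using less.prems(1) by (rule finite_subset) simp
  show ?case
  proof (cases "N \<le> t")
    case True
    have "card E \<le> card ({..<N} \<times> {..<N})" using less.prems(1) by (intro card_mono) auto
    also have "\<dots> = N * N" by (simp add: card_cartesian_product)
    also have "\<dots> \<le> t * N" using True by simp
    finally have "3 * card E \<le> 24 * (S * S) * N" unfolding t by (simp add: mult_ac)
    also have "\<dots> \<le> 128 * (S * (S * S)) * N" using SS by (intro mult_le_mono1) linarith
    also have "\<dots> \<le> k * (128 * (S * (S * S)) * N)" using k by simp
    also have "\<dots> = 16 * k * 8 ^ k * N" unfolding S8 by (simp add: algebra_simps)
    finally show ?thesis .
  next
    case False
    define N' where "N' = Suc ((N - 1) div t)"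
    define F where "F = map_prod id (\<lambda>y. y div 2 ^ a) ` E"
    define G where "G = map_prod (\<lambda>x. x div 2 ^ a) id ` F"
    have "t \<ge> 8" using \<open>S \<ge> 1\<close> unfolding t by simp
    have div: "x div t < N'" if "x < N" for x
    proof -
      have "x \<le> N - 1" using that by simp
      then show ?thesis unfolding N'_def less_Suc_eq_le by (rule div_le_mono)
    qed
    have FN: "F \<subseteq> {..<N} \<times> {..<N'}" "G \<subseteq> {..<N'} \<times> {..<N'}"
      using less.prems(1) div unfolding G_def F_def t_def by auto
    have fin: "finite F" "finite G" unfolding G_def F_def using finE by auto
    have m: "mono (\<lambda>x::nat. x div 2 ^ a)" "mono (id :: nat \<Rightarrow> nat)"
      by (auto simp: mono_def div_le_mono)
    have nF: "\<not> grid_minor k k F"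
      using less.prems(2) grid_minor_image m unfolding F_def by blast
    then have nG: "\<not> grid_minor k k G"
      using grid_minor_image m unfolding G_def by blast
    have "(N - 1) div t * t \<le> N - 1" by simp
    moreover have "t * N' = t + (N - 1) div t * t" unfolding N'_def by (simp add: mult.commute)
    ultimately have tN: "t * N' \<le> 2 * N" using False by linarith
    have "8 * N' \<le> t * N'" using \<open>t \<ge> 8\<close> by simp
    then have "N' < N" using tN False \<open>t \<ge> 8\<close> by linarith
    then have IH: "3 * card G \<le> 16 * k * 8 ^ k * N'" using less.IH FN nG by blast
    have "card (snd ` F) \<le> card {..<N'}" using FN by (intro card_mono) auto
    then have "f * (t * card (snd ` F)) \<le> f * (t * N')" by (simp add: mult_le_mono2)
    moreover have "card E \<le> S * card F + f * (t * card (snd ` F))"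
      using card_contract_columns[of E k l a] finE less.prems(2)
      unfolding k S_def f_def t_def F_def by (simp add: mult_ac)
    ultimately have E: "card E \<le> S * card F + f * (t * N')" by linarith
    have "card (fst ` G) \<le> card {..<N'}" using FN by (intro card_mono) auto
    then have "f * (t * card (fst ` G)) \<le> f * (t * N')" by (simp add: mult_le_mono2)
    moreover have "card F \<le> S * card G + f * (t * card (fst ` G))"
      using card_contract_rows[of F l k a] fin nF
      unfolding k S_def f_def t_def G_def by (simp add: mult_ac)
    ultimately have "card F \<le> S * card G + f * (t * N')" by linarith
    then have "S * card F \<le> S * (S * card G + f * (t * N'))" by (rule mult_le_mono2)
    with E have "card E \<le> S * (S * card G + f * (t * N')) + f * (t * N')" by linarith
    also have "\<dots> = S * S * card G + (S + 1) * (f * (t * N'))" by (simp add: algebra_simps)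
    finally have "3 * card E \<le> S * S * (3 * card G) + 3 * ((S + 1) * (f * (t * N')))" by simp
    moreover have "S * S * (3 * card G) \<le> 4 * k * 8 ^ k * N"
    proof -
      have "S * S * (3 * card G) \<le> S * S * (16 * k * 8 ^ k * N')" using IH by (rule mult_le_mono2)
      also have "\<dots> = 2 * k * 8 ^ k * (t * N')" unfolding t by simp
      also have "\<dots> \<le> 2 * k * 8 ^ k * (2 * N)" using tN by (rule mult_le_mono2)
      finally show ?thesis by simp
    qed
    moreover have "3 * ((S + 1) * (f * (t * N'))) \<le> 12 * k * 8 ^ k * N"
    proof -
      \<comment> \<open>The crude binomial bound suffices: the remainders are then at most 4 k S t
        N, and S t = 8 S^3 = 8^k.\<close>
      have "a choose l \<le> t" unfolding t_def by (rule binomial_le_pow2)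
      then have "f \<le> k * t" unfolding f_def k by (intro mult_le_mono) auto
      moreover have "S + 1 \<le> 2 * S" using \<open>S \<ge> 1\<close> by simp
      ultimately have "(S + 1) * (f * (t * N')) \<le> (2 * S) * ((k * t) * (2 * N))"
        using mult_le_mono[OF _ mult_le_mono[OF _ tN]] by blast
      also have "\<dots> = 4 * k * 8 ^ k * N" unfolding t S8 by simp
      finally show ?thesis by simp
    qed
    ultimately show ?thesis by simp
  qed
qed

section \<open>Corners and mixed values\<close>

definition corners :: "(nat \<Rightarrow> nat \<Rightarrow> 'a) \<Rightarrow> nat \<Rightarrow> nat \<Rightarrow> (nat \<times> nat) set" where
  "corners f n m = {(x, y). Suc x < n \<and> Suc y < m \<and>
     \<not> (f x y = f (Suc x) y \<and> f x (Suc y) = f (Suc x) (Suc y)) \<and>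
     \<not> (f x y = f x (Suc y) \<and> f (Suc x) y = f (Suc x) (Suc y))}"

lemma corners_converse: "(corners f n m)\<inverse> = corners (\<lambda>x y. f y x) m n"
  unfolding corners_def by auto

lemma finite_corners: "finite (corners f n m)"
  by (rule finite_subset[of _ "{..<n} \<times> {..<m}"]) (auto simp: corners_def)

lemma interval_propagate:
  fixes P :: "nat \<Rightarrow> bool"
  assumes "P j" "a \<le> j" "j \<le> b" "\<And>y. a \<le> y \<Longrightarrow> y < b \<Longrightarrow> P y \<longleftrightarrow> P (Suc y)"
  shows "a \<le> y \<Longrightarrow> y \<le> b \<Longrightarrow> P y"
proof -
  have up: "y \<le> b \<longrightarrow> P y" if "j \<le> y" for y
    using that
  proof (induction y rule: dec_induct)
    case (step y)
    then show ?case using assms(4)[of y] assms(2) by simp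
  qed (use assms(1) in simp)
  have down: "a \<le> y \<longrightarrow> P y" if "y \<le> j" for y
    using that
  proof (induction y rule: inc_induct)
    case (step y)
    then show ?case using assms(4)[of y] assms(3) by simp
  qed (use assms(1) in simp)
  show "a \<le> y \<Longrightarrow> y \<le> b \<Longrightarrow> P y" using up down by (cases "j \<le> y") auto
qed

text \<open>In a square that is no corner, the two rows differ in the left column iff they differ in
  the right one. A change between two consecutive rows therefore runs through the whole rectangle,
  and so does a change between two columns. The square where two such lines cross would be a
  corner.\<close>

lemma rectangle_without_corner:
  assumes no: "\<And>x y. a \<le> x \<Longrightarrow> x < b \<Longrightarrow> c \<le> y \<Longrightarrow> y < d \<Longrightarrow> (x, y) \<notin> corners f n m"
    and "b < n" "d < m"
  shows "(\<forall>x\<in>{a..<b}. \<forall>y\<in>{c..d}. f x y = f (Suc x) y) \<or>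
    (\<forall>x\<in>{a..b}. \<forall>y\<in>{c..<d}. f x y = f x (Suc y))"
proof (rule ccontr)
  assume "\<not> ?thesis"
  then obtain i j i' j' where ij: "a \<le> i" "i < b" "c \<le> j" "j \<le> d" "f i j \<noteq> f (Suc i) j"
    and ij': "a \<le> i'" "i' \<le> b" "c \<le> j'" "j' < d" "f i' j' \<noteq> f i' (Suc j')" by auto
  have sq: "f x y = f (Suc x) y \<and> f x (Suc y) = f (Suc x) (Suc y) \<or>
      f x y = f x (Suc y) \<and> f (Suc x) y = f (Suc x) (Suc y)"
    if "a \<le> x" "x < b" "c \<le> y" "y < d" for x y
    using no[OF that] that \<open>b < n\<close> \<open>d < m\<close> unfolding corners_def by auto
  have "f i y \<noteq> f (Suc i) y" if "c \<le> y" "y \<le> d" for y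
  proof (rule interval_propagate[where j = j and a = c and b = d and P = "\<lambda>y. f i y \<noteq> f (Suc i) y"])
    show "(f i y \<noteq> f (Suc i) y) = (f i (Suc y) \<noteq> f (Suc i) (Suc y))" if "c \<le> y" "y < d" for y
      using sq[of i y] ij that by auto
  qed (use ij that in auto)
  then have "f i j' = f i (Suc j')" using sq[of i j'] ij ij' by auto
  moreover have "f x j' \<noteq> f x (Suc j')" if "a \<le> x" "x \<le> b" for x
  proof (rule interval_propagate[where j = i' and a = a and b = b and P = "\<lambda>x. f x j' \<noteq> f x (Suc j')"])
    show "(f x j' \<noteq> f x (Suc j')) = (f (Suc x) j' \<noteq> f (Suc x) (Suc j'))" if "a \<le> x" "x < b" for x
      using sq[of x j'] ij' that by auto
  qed (use ij' that in auto)
  ultimately show False using ij by auto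
qed

section \<open>Consecutive parts as labels, and their mixed values\<close>

text \<open>A partition into consecutive parts, given by the number of the part of each index. For
  \<open>n\<close> rows the last part has number \<open>r (n - 1)\<close>, which later serves in the
  induction measure.\<close>

definition labelling :: "(nat \<Rightarrow> nat) \<Rightarrow> bool" where
  "labelling r \<longleftrightarrow> r 0 = 0 \<and> (\<forall>x. r x \<le> r (Suc x) \<and> r (Suc x) \<le> Suc (r x))"

lemma labelling_mono: "labelling r \<Longrightarrow> mono r"
  unfolding labelling_def by (simp add: mono_iff_le_Suc)

definition merge_at :: "nat \<Rightarrow> nat \<Rightarrow> nat" where
  "merge_at i z = (if z \<le> i then z else z - 1)"

lemma labelling_merge_at:
  assumes "labelling r"
  shows "labelling (merge_at i \<circ> r)"
  unfolding labelling_def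
proof (intro conjI allI)
  show "(merge_at i \<circ> r) 0 = 0" using assms by (simp add: labelling_def merge_at_def)
  fix x
  have "r (Suc x) = r x \<or> r (Suc x) = Suc (r x)"
    using assms unfolding labelling_def by (metis le_SucE le_antisym)
  then show "(merge_at i \<circ> r) x \<le> (merge_at i \<circ> r) (Suc x)"
    "(merge_at i \<circ> r) (Suc x) \<le> Suc ((merge_at i \<circ> r) x)"
    by (elim disjE; simp add: merge_at_def)+
qed

text \<open>A corner \<open>(x, y)\<close> is attributed to the column part of \<open>y\<close> even if \<open>y + 1\<close> lies in the next
  part, so this counts the mixed zones and the mixed cuts of the row part \<open>i\<close> together.\<close>

definition mixed_value ::
    "(nat \<times> nat) set \<Rightarrow> (nat \<Rightarrow> nat) \<Rightarrow> (nat \<Rightarrow> nat) \<Rightarrow> nat \<Rightarrow> nat" where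
  "mixed_value E r c i = card (c ` {y. \<exists>x. (x, y) \<in> E \<and> r x = i \<and> r (Suc x) = i})"

definition low_mixed_values ::
    "nat \<Rightarrow> (nat \<times> nat) set \<Rightarrow> (nat \<Rightarrow> nat) \<Rightarrow> (nat \<Rightarrow> nat) \<Rightarrow> bool" where
  "low_mixed_values K E r c \<longleftrightarrow>
    (\<forall>i. mixed_value E r c i \<le> K) \<and> (\<forall>j. mixed_value (E\<inverse>) c r j \<le> K)"

lemma low_mixed_values_converse: "low_mixed_values K (E\<inverse>) c r \<longleftrightarrow> low_mixed_values K E r c"
  unfolding low_mixed_values_def by auto

text \<open>The whole 2 x 2 square has to lie in its cell, whereas \<open>grid_minor\<close> would
  only place its upper left entry.\<close>

definition corner_minor :: "nat \<Rightarrow> (nat \<times> nat) set \<Rightarrow> bool" where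
  "corner_minor k E \<longleftrightarrow> (\<exists>\<rho> \<chi> :: nat \<Rightarrow> nat. mono \<rho> \<and> mono \<chi> \<and>
    (\<forall>i<k. \<forall>j<k. \<exists>x y. (x, y) \<in> E \<and> \<rho> x = i \<and> \<rho> (Suc x) = i \<and> \<chi> y = j \<and> \<chi> (Suc y) = j))"

lemma corner_minor_converse: "corner_minor k (E\<inverse>) \<Longrightarrow> corner_minor k E"
  unfolding corner_minor_def by (simp; blast)

text \<open>\<open>F\<close> consists of pairs of labels. Rounding an even row label and its
  successor to \<open>i\<close>, and \<open>j\<close> and its successor to \<open>j\<close> by
  \<open>g\<close>, puts a square into one fibre even if it crosses the cut between the paired
  parts. The map \<open>g\<close> is left open because both parities of \<open>j\<close>
  occur.\<close>

lemma corner_minor_of_grid_minor: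
  assumes r: "labelling r" and c: "labelling c" and "mono g"
    and F: "\<And>i j. (i, j) \<in> F \<Longrightarrow> even i \<and> g j = j \<and> g (Suc j) = j \<and>
      (\<exists>x y. (x, y) \<in> E \<and> r x \<in> {i, Suc i} \<and> r (Suc x) \<in> {i, Suc i} \<and> c y = j)"
    and minor: "grid_minor k k F"
  shows "corner_minor k E"
proof -
  obtain \<rho> \<chi> :: "nat \<Rightarrow> nat" where m: "mono \<rho>" "mono \<chi>"
    and sur: "{..<k} \<times> {..<k} \<subseteq> map_prod \<rho> \<chi> ` F"
    using minor unfolding grid_minor_def by blast
  define e where "e z = 2 * (z div 2)" for z :: nat
  have "mono e" unfolding e_def mono_def by (simp add: div_le_mono)
  have "mono (\<lambda>x. \<rho> (e (r x)))" "mono (\<lambda>y. \<chi> (g (c y)))"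
    using m \<open>mono e\<close> \<open>mono g\<close> labelling_mono[OF r] labelling_mono[OF c] by (auto simp: mono_def)
  moreover have "\<exists>x y. (x, y) \<in> E \<and> \<rho> (e (r x)) = a \<and> \<rho> (e (r (Suc x))) = a \<and>
      \<chi> (g (c y)) = b \<and> \<chi> (g (c (Suc y))) = b" if "a < k" "b < k" for a b
  proof -
    have "(a, b) \<in> map_prod \<rho> \<chi> ` F" using sur that by blast
    then obtain i j where "(i, j) \<in> F" "\<rho> i = a" "\<chi> j = b" by auto
    then obtain x y where i: "even i" and j: "g j = j" "g (Suc j) = j" and "(x, y) \<in> E"
      and rx: "r x \<in> {i, Suc i}" "r (Suc x) \<in> {i, Suc i}" and "c y = j"
      using F by blast
    have "e i = i" "e (Suc i) = i" using i by (auto simp: e_def)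
    then have "e (r x) = i" "e (r (Suc x)) = i" using rx by auto
    moreover have "c (Suc y) = j \<or> c (Suc y) = Suc j"
      using c \<open>c y = j\<close> unfolding labelling_def by (metis le_SucE le_antisym)
    then have "g (c y) = j" "g (c (Suc y)) = j" using j \<open>c y = j\<close> by auto
    ultimately show ?thesis using \<open>(x, y) \<in> E\<close> \<open>\<rho> i = a\<close> \<open>\<chi> j = b\<close> by metis
  qed
  ultimately show ?thesis unfolding corner_minor_def by blast
qed

section \<open>Greedy merging of consecutive parts\<close>

text \<open>If every merge fails, each of the disjoint pairs \<open>i\<close>, \<open>Suc i\<close>
  with \<open>i\<close> even sees more than \<open>K\<close> column labels. Merging on the side with
  at least as many parts keeps all labels below \<open>p\<close>, so that the bound for squares
  applies.\<close>

lemma exists_row_merge: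
  assumes r: "labelling r" and c: "labelling c"
    and E: "\<And>x y. (x, y) \<in> E \<Longrightarrow> Suc x < n \<and> Suc y < m"
    and p: "c (m - 1) \<le> r (n - 1)" "1 \<le> r (n - 1)"
    and k: "1 \<le> k" "32 * k * 8 ^ k \<le> K"
    and no: "\<not> corner_minor k E"
  shows "\<exists>i < r (n - 1). mixed_value E (merge_at i \<circ> r) c i \<le> K"
proof (rule ccontr)
  assume "\<not> ?thesis"
  then have big: "K + 1 \<le> mixed_value E (merge_at i \<circ> r) c i" if "i < r (n - 1)" for i
    using that by force
  define p where "p = Suc (r (n - 1))"
  define I where "I = (\<lambda>i. 2 * i) ` {..<p div 2}"
  define C where "C i = c ` {y. \<exists>x. (x, y) \<in> E \<and> (merge_at i \<circ> r) x = i \<and> (merge_at i \<circ> r) (Suc x) = i}" for i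
  define F where "F = Sigma I C"
  have "finite E" by (rule finite_subset[of _ "{..<n} \<times> {..<m}"]) (use E in fastforce)+
  have finC: "finite (C i)" for i
  proof -
    have "C i \<subseteq> c ` snd ` E" unfolding C_def by force
    then show ?thesis using \<open>finite E\<close> finite_subset by blast
  qed
  have "finite I" unfolding I_def by simp
  have cardF: "(K + 1) * (p div 2) \<le> card F"
  proof -
    have "card I = p div 2" unfolding I_def by (subst card_image) (auto simp: inj_on_def)
    then have "(K + 1) * (p div 2) = (\<Sum>i\<in>I. K + 1)" by simp
    also have "\<dots> \<le> (\<Sum>i\<in>I. card (C i))"
    proof (rule sum_mono)
      fix i assume "i \<in> I"
      then have "i < r (n - 1)" unfolding I_def p_def by auto
      then show "K + 1 \<le> card (C i)" using big unfolding C_def mixed_value_def by auto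
    qed
    also have "\<dots> = card F" unfolding F_def using \<open>finite I\<close> finC by simp
    finally show ?thesis .
  qed
  have F: "even i \<and> i < p \<and> j < p \<and> (\<exists>x y. (x, y) \<in> E \<and> r x \<in> {i, Suc i} \<and> r (Suc x) \<in> {i, Suc i} \<and> c y = j)"
    if ij: "(i, j) \<in> F" for i j
  proof -
    obtain x y where xy: "(x, y) \<in> E" "merge_at i (r x) = i" "merge_at i (r (Suc x)) = i" "c y = j"
      using ij unfolding F_def C_def by auto
    have "y \<le> m - 1" using E[OF xy(1)] by linarith
    then have "c y \<le> c (m - 1)" using labelling_mono[OF c] by (simp add: monoD)
    then have "j < p" using xy(4) p unfolding p_def by simp
    moreover have "even i" "i < p" using ij unfolding F_def I_def by auto
    moreover have "r x \<in> {i, Suc i}" "r (Suc x) \<in> {i, Suc i}"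
      using xy unfolding merge_at_def by (auto split: if_splits)
    ultimately show ?thesis using xy by blast
  qed
  \<comment> \<open>A corner attributed to the column part \<open>j\<close> may straddle the parts \<open>j\<close> and \<open>j + 1\<close>; parity makes
    the pairs \<open>{j, j + 1}\<close> disjoint.\<close>
  define F0 where "F0 = {(i, j) \<in> F. even j}"
  define F1 where "F1 = {(i, j) \<in> F. odd j}"
  have "\<not> grid_minor k k F0"
  proof
    assume "grid_minor k k F0"
    have "corner_minor k E"
    proof (rule corner_minor_of_grid_minor[OF r c _ _ \<open>grid_minor k k F0\<close>, where g = "\<lambda>z. 2 * (z div 2)"])
      show "mono (\<lambda>z::nat. 2 * (z div 2))" by (simp add: mono_def div_le_mono)
    qed (use F in \<open>auto simp: F0_def\<close>)
    then show False using no by blast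
  qed
  moreover have "\<not> grid_minor k k F1"
  proof
    assume "grid_minor k k F1"
    \<comment> \<open>This \<open>g\<close> rounds an odd label and its successor to the odd one; at
      0 the truncated subtraction gives 0, which keeps it monotone.\<close>
    have "corner_minor k E"
    proof (rule corner_minor_of_grid_minor[OF r c _ _ \<open>grid_minor k k F1\<close>, where g = "\<lambda>z. 2 * (Suc z div 2) - 1"])
      have "2 * (Suc x div 2) \<le> 2 * (Suc y div 2)" if "x \<le> y" for x y
        using that by (intro mult_le_mono2 div_le_mono) simp
      then show "mono (\<lambda>z::nat. 2 * (Suc z div 2) - 1)" by (simp add: mono_def diff_le_mono)
    next
      fix i j assume "(i, j) \<in> F1"
      moreover have "2 * (Suc j div 2) - 1 = j \<and> 2 * (Suc (Suc j) div 2) - 1 = j" if "odd j"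
        using that by (auto elim!: oddE)
      ultimately show "even i \<and> 2 * (Suc j div 2) - 1 = j \<and> 2 * (Suc (Suc j) div 2) - 1 = j \<and>
        (\<exists>x y. (x, y) \<in> E \<and> r x \<in> {i, Suc i} \<and> r (Suc x) \<in> {i, Suc i} \<and> c y = j)"
        using F unfolding F1_def by blast
    qed
    then show False using no by blast
  qed
  moreover have sub: "F0 \<subseteq> {..<p} \<times> {..<p}" "F1 \<subseteq> {..<p} \<times> {..<p}"
    using F unfolding F0_def F1_def by auto
  ultimately have "3 * card F0 \<le> 16 * k * 8 ^ k * p" "3 * card F1 \<le> 16 * k * 8 ^ k * p"
    using card_no_grid_minor k by blast+
  moreover have "card F = card F0 + card F1"
  proof -
    have "F = F0 \<union> F1" unfolding F0_def F1_def by auto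
    moreover have "finite F0" "finite F1" using sub finite_subset[of _ "{..<p} \<times> {..<p}"] by auto
    moreover have "F0 \<inter> F1 = {}" unfolding F0_def F1_def by auto
    ultimately show ?thesis by (simp add: card_Un_disjoint)
  qed
  ultimately have "3 * card F \<le> (32 * k * 8 ^ k) * p" by (simp add: algebra_simps)
  also have "\<dots> \<le> K * p" using k by simp
  also have "\<dots> < (K + 1) * p" unfolding p_def by simp
  also have "\<dots> \<le> (K + 1) * (3 * (p div 2))"
  proof -
    have "p \<ge> 2" using p unfolding p_def by simp
    \<comment> \<open>The extreme case is p = 3, where only one pair is formed.\<close>
    then have "p \<le> 3 * (p div 2)" by presburger
    then show ?thesis by (rule mult_le_mono2)
  qed
  also have "\<dots> \<le> 3 * card F" using cardF by simp
  finally show False by simp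
qed

text \<open>Only the part \<open>i\<close> is at risk: the other row parts keep their rows and are
  at most renumbered, while for a column part the counted row labels are identified, which cannot
  raise their number.\<close>

lemma low_mixed_values_merge_at:
  assumes low: "low_mixed_values K E r c" and "finite E"
    and i: "mixed_value E (merge_at i \<circ> r) c i \<le> K"
  shows "low_mixed_values K E (merge_at i \<circ> r) c"
  unfolding low_mixed_values_def
proof (intro conjI allI)
  fix l
  show "mixed_value E (merge_at i \<circ> r) c l \<le> K"
  proof (cases "l = i")
    case False
    define l' where "l' = (if l < i then l else Suc l)"
    have "(merge_at i (r x) = l) \<longleftrightarrow> r x = l'" for x
      using False unfolding l'_def merge_at_def by auto
    then have "mixed_value E (merge_at i \<circ> r) c l = mixed_value E r c l'"
      unfolding mixed_value_def by simp
    then show ?thesis using low unfolding low_mixed_values_def by simp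
  qed (use i in simp)
next
  fix j
  let ?S = "{x. \<exists>y. (y, x) \<in> E\<inverse> \<and> c y = j \<and> c (Suc y) = j}"
  have "?S \<subseteq> fst ` E" by force
  then have "finite ?S" using \<open>finite E\<close> finite_subset by blast
  then have "card (merge_at i ` r ` ?S) \<le> card (r ` ?S)" by (intro card_image_le) simp
  then have "mixed_value (E\<inverse>) c (merge_at i \<circ> r) j \<le> mixed_value (E\<inverse>) c r j"
    unfolding mixed_value_def by (simp add: image_comp)
  then show "mixed_value (E\<inverse>) c (merge_at i \<circ> r) j \<le> K"
    using low unfolding low_mixed_values_def by (meson order_trans)
qed

lemma exists_merge:
  assumes r: "labelling r" and c: "labelling c"
    and E: "\<And>x y. (x, y) \<in> E \<Longrightarrow> Suc x < n \<and> Suc y < m"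
    and k: "1 \<le> k" "32 * k * 8 ^ k \<le> K"
    and no: "\<not> corner_minor k E"
    and low: "low_mixed_values K E r c"
    and pos: "r (n - 1) + c (m - 1) > 0"
  shows "(\<exists>i < r (n - 1). low_mixed_values K E (merge_at i \<circ> r) c) \<or>
    (\<exists>j < c (m - 1). low_mixed_values K E r (merge_at j \<circ> c))"
proof -
  have "finite E" by (rule finite_subset[of _ "{..<n} \<times> {..<m}"]) (use E in fastforce)+
  show ?thesis
  proof (cases "c (m - 1) \<le> r (n - 1)")
    case True
    then have "1 \<le> r (n - 1)" using pos by linarith
    then show ?thesis
      using exists_row_merge[OF r c E True _ k no] low_mixed_values_merge_at[OF low \<open>finite E\<close>] by blast
  next
    case False
    then have "r (n - 1) \<le> c (m - 1)" "1 \<le> c (m - 1)" by simp_all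
    moreover have "\<not> corner_minor k (E\<inverse>)" using no corner_minor_converse by blast
    moreover have "Suc x < m \<and> Suc y < n" if "(x, y) \<in> E\<inverse>" for x y using E that by blast
    ultimately have "\<exists>j < c (m - 1). mixed_value (E\<inverse>) (merge_at j \<circ> c) r j \<le> K"
      using exists_row_merge[OF c r, of "E\<inverse>" m n] k by blast
    then show ?thesis
      using low_mixed_values_merge_at[of K "E\<inverse>" c r] low \<open>finite E\<close>
      unfolding low_mixed_values_converse by auto
  qed
qed

section \<open>Refinement by row and column classes\<close>

text \<open>Unlike in \<open>mixed_value\<close>, a corner on a cut does not count: rows are to be
  compared on every zone without an inner corner.\<close>

definition mixed_zone ::
    "(nat \<times> nat) set \<Rightarrow> (nat \<Rightarrow> nat) \<Rightarrow> (nat \<Rightarrow> nat) \<Rightarrow> nat \<Rightarrow> nat \<Rightarrow> bool" where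
  "mixed_zone E r c i j \<longleftrightarrow>
    (\<exists>x y. (x, y) \<in> E \<and> r x = i \<and> r (Suc x) = i \<and> c y = j \<and> c (Suc y) = j)"

lemma mixed_zone_converse: "mixed_zone (E\<inverse>) c r j i \<longleftrightarrow> mixed_zone E r c i j"
  unfolding mixed_zone_def by auto

lemma card_mixed_zones:
  assumes "finite E"
  shows "finite {j. mixed_zone E r c i j}" "card {j. mixed_zone E r c i j} \<le> mixed_value E r c i"
proof -
  let ?C = "c ` {y. \<exists>x. (x, y) \<in> E \<and> r x = i \<and> r (Suc x) = i}"
  have "?C \<subseteq> c ` snd ` E" by force
  then have "finite ?C" using assms finite_subset by blast
  moreover have "{j. mixed_zone E r c i j} \<subseteq> ?C" unfolding mixed_zone_def by blast
  ultimately show "finite {j. mixed_zone E r c i j}"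
    "card {j. mixed_zone E r c i j} \<le> mixed_value E r c i"
    unfolding mixed_value_def by (auto intro: finite_subset card_mono)
qed

lemma mixed_zone_comp:
  "mixed_zone E r c i j \<Longrightarrow> mixed_zone E (g \<circ> r) (h \<circ> c) (g i) (h j)"
  unfolding mixed_zone_def comp_def by metis

definition row_equiv ::
    "(nat \<Rightarrow> nat \<Rightarrow> 'a) \<Rightarrow> nat \<Rightarrow> nat \<Rightarrow> (nat \<Rightarrow> nat) \<Rightarrow> (nat \<Rightarrow> nat) \<Rightarrow> (nat \<times> nat) set" where
  "row_equiv f n m r c = {(x, x'). x < n \<and> x' < n \<and> r x = r x' \<and>
     (\<forall>y<m. \<not> mixed_zone (corners f n m) r c (r x) (c y) \<longrightarrow> f x y = f x' y)}"

abbreviation col_equiv ::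
    "(nat \<Rightarrow> nat \<Rightarrow> 'a) \<Rightarrow> nat \<Rightarrow> nat \<Rightarrow> (nat \<Rightarrow> nat) \<Rightarrow> (nat \<Rightarrow> nat) \<Rightarrow> (nat \<times> nat) set" where
  "col_equiv f n m r c \<equiv> row_equiv (\<lambda>x y. f y x) m n c r"

lemma equiv_row_equiv: "equiv {..<n} (row_equiv f n m r c)"
  by (rule equivI) (auto simp: row_equiv_def refl_on_def sym_def trans_def)

lemma col_equiv_iff:
  "(y, y') \<in> col_equiv f n m r c \<longleftrightarrow> y < m \<and> y' < m \<and> c y = c y' \<and>
     (\<forall>x<n. \<not> mixed_zone (corners f n m) r c (r x) (c y) \<longrightarrow> f x y = f x y')"
  unfolding row_equiv_def corners_converse[of f n m, symmetric] mixed_zone_converse by simp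

text \<open>Coarser labels turn more zones into mixed ones, so fewer entries are compared and the
  classes grow. This makes the next refinement reachable by merges alone.\<close>

lemma row_equiv_comp: "row_equiv f n m r c \<subseteq> row_equiv f n m (g \<circ> r) (h \<circ> c)"
  unfolding row_equiv_def using mixed_zone_comp by fastforce

lemma step_constant:
  assumes "\<forall>z\<in>{a..<b}. g z = g (Suc z)" "a \<le> b"
  shows "g a = g (b :: nat)"
  using assms(2,1) by (induction rule: dec_induct) auto

text \<open>The rectangle spanned by the two rows and the two columns has no corner: one before the
  part of \<open>y'\<close> is excluded by \<open>gap\<close>, and one inside that part would make
  its zone mixed. So either the two rows agree throughout, or each row has the same entry in both
  columns.\<close>

lemma equal_rows_transfer:
  assumes r: "mono r" and c: "mono c" and x: "x < n" "x' < n" "r x = i" "r x' = i"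
    and y: "y \<le> y'" "y' < m"
    and gap: "\<And>j z. (z, j) \<in> corners f n m \<Longrightarrow> r z = i \<Longrightarrow> r (Suc z) = i \<Longrightarrow> \<not> (c y \<le> c j \<and> c j < c y')"
    and nm: "\<not> mixed_zone (corners f n m) r c i (c y')"
  shows "f x y = f x' y \<longleftrightarrow> f x y' = f x' y'"
proof -
  define a where "a = min x x'"
  define b where "b = max x x'"
  have ab: "a \<le> b" "r a = i" "r b = i" "b < n" using x unfolding a_def b_def by (auto simp: min_def max_def)
  have ri: "r u = i" if "a \<le> u" "u \<le> b" for u
    using ab monoD[OF r \<open>a \<le> u\<close>] monoD[OF r \<open>u \<le> b\<close>] by simp
  have no: "(u, z) \<notin> corners f n m" if u: "a \<le> u" "u < b" and z: "y \<le> z" "z < y'" for u z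
  proof
    assume uz: "(u, z) \<in> corners f n m"
    have "r u = i" "r (Suc u) = i" using ri u by auto
    moreover have "c y \<le> c z" "c z \<le> c (Suc z)" "c (Suc z) \<le> c y'" using c z by (auto simp: monoD)
    ultimately have "c z = c y'" "c (Suc z) = c y'" using gap[OF uz] by auto
    then show False using nm uz \<open>r u = i\<close> \<open>r (Suc u) = i\<close> unfolding mixed_zone_def by blast
  qed
  from rectangle_without_corner[of a b y y' f n m, OF no ab(4) y(2)]
  consider "\<forall>u\<in>{a..<b}. \<forall>z\<in>{y..y'}. f u z = f (Suc u) z" | "\<forall>u\<in>{a..b}. \<forall>z\<in>{y..<y'}. f u z = f u (Suc z)"
    by blast
  then show ?thesis
  proof cases
    case 1
    have "f a z = f b z" if "z \<in> {y..y'}" for z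
      using step_constant[of a b "\<lambda>u. f u z"] 1 that ab by blast
    then have "f x z = f x' z" if "z \<in> {y..y'}" for z
      using that by (cases "x \<le> x'") (fastforce simp: a_def b_def)+
    then show ?thesis using y by auto
  next
    case 2
    have "f u y = f u y'" if "u \<in> {a..b}" for u
      using step_constant[of y y' "f u"] 2 that y by blast
    then have "f x y = f x y'" "f x' y = f x' y'" unfolding a_def b_def by auto
    then show ?thesis by simp
  qed
qed

text \<open>A row is coded by its entry in one chosen column of each of the \<open>K + 1\<close>
  runs. Equal codes force equivalence, since \<open>equal_rows_transfer\<close> carries equality
  from the chosen column to the rest of the run.\<close>

lemma card_row_classes:
  assumes A: "finite A" "A \<noteq> {}" "\<And>x y. x < n \<Longrightarrow> y < m \<Longrightarrow> f x y \<in> A"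
    and r: "mono r" and c: "mono c"
    and K: "mixed_value (corners f n m) r c i \<le> K"
  shows "card {X \<in> {..<n} // row_equiv f n m r c. X \<subseteq> {x. r x = i}} \<le> card A ^ Suc K"
proof -
  define E where "E = corners f n m"
  define B where "B = c ` {y. \<exists>x. (x, y) \<in> E \<and> r x = i \<and> r (Suc x) = i}"
  \<comment> \<open>\<open>\<beta>\<close> numbers the runs of column parts between consecutive elements of \<open>B\<close>; a row is determined
    up to equivalence by one entry in each run.\<close>
  define \<beta> where "\<beta> y = card {j \<in> B. j < c y}" for y
  define Y where "Y b = {y. y < m \<and> \<not> mixed_zone E r c i (c y) \<and> \<beta> y = b}" for b
  define a where "a = (SOME a. a \<in> A)"
  \<comment> \<open>A run without an unmixed zone gets the default letter \<open>a\<close>, so that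
    every code has its values in \<open>A\<close>.\<close>
  define \<sigma> where "\<sigma> x = (\<lambda>b\<in>{..K}. if Y b = {} then a else f x (SOME y. y \<in> Y b))" for x
  define Q where "Q = {X \<in> {..<n} // row_equiv f n m r c. X \<subseteq> {x. r x = i}}"
  have "a \<in> A" unfolding a_def using A(2) by (simp add: some_in_eq)
  have "finite E" unfolding E_def by (rule finite_corners)
  have "B \<subseteq> c ` snd ` E" unfolding B_def by force
  then have "finite B" using \<open>finite E\<close> finite_subset by blast
  have "card B \<le> K" using K unfolding B_def mixed_value_def E_def .
  then have \<beta>K: "\<beta> y \<le> K" for y
    unfolding \<beta>_def using card_mono[OF \<open>finite B\<close>, of "{j \<in> B. j < c y}"] by auto
  \<comment> \<open>It matters that \<open>\<beta>\<close> counts strictly: a part in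
    \<open>B\<close> whose zone is not mixed has its corners only on the cut after it, so it still
    belongs to the run before that cut.\<close>
  have gap: "\<not> (c y \<le> j \<and> j < c y')" if "\<beta> y = \<beta> y'" "j \<in> B" "y \<le> y'" for y y' j
  proof
    assume j: "c y \<le> j \<and> j < c y'"
    have "c y \<le> c y'" using c that by (simp add: monoD)
    then have "{j \<in> B. j < c y} \<subseteq> {j \<in> B. j < c y'}" by auto
    moreover have "j \<in> {j \<in> B. j < c y'}" "j \<notin> {j \<in> B. j < c y}" using j \<open>j \<in> B\<close> by auto
    ultimately have "{j \<in> B. j < c y} \<subset> {j \<in> B. j < c y'}" by blast
    then have "\<beta> y < \<beta> y'" unfolding \<beta>_def using \<open>finite B\<close> by (intro psubset_card_mono) auto
    then show False using that by simp
  qed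
  have same: "f x y = f x' y \<longleftrightarrow> f x y' = f x' y'"
    if "x < n" "x' < n" "r x = i" "r x' = i" "y \<in> Y b" "y' \<in> Y b" "y \<le> y'" for x x' y y' b
  proof (rule equal_rows_transfer[OF r c that(1-4) that(7)])
    show "y' < m" "\<not> mixed_zone (corners f n m) r c i (c y')" using that unfolding Y_def E_def by auto
    show "\<not> (c y \<le> c j \<and> c j < c y')"
      if "(z, j) \<in> corners f n m" "r z = i" "r (Suc z) = i" for z j
    proof (rule gap)
      show "\<beta> y = \<beta> y'" using \<open>y \<in> Y b\<close> \<open>y' \<in> Y b\<close> unfolding Y_def by simp
      show "c j \<in> B" using that unfolding B_def E_def by blast
    qed fact
  qed
  have \<sigma>: "(x, x') \<in> row_equiv f n m r c"
    if x: "x < n" "x' < n" "r x = i" "r x' = i" and eq: "\<sigma> x = \<sigma> x'" for x x'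
    unfolding row_equiv_def
  proof (clarsimp simp: x, fold E_def)
    fix y assume y: "y < m" "\<not> mixed_zone E r c i (c y)"
    define b where "b = \<beta> y"
    define z where "z = (SOME y. y \<in> Y b)"
    have "y \<in> Y b" using y unfolding Y_def b_def by simp
    then have "z \<in> Y b" unfolding z_def by (rule someI)
    have "b \<in> {..K}" using \<beta>K unfolding b_def by simp
    moreover have "Y b \<noteq> {}" using \<open>y \<in> Y b\<close> by blast
    ultimately have "f x z = f x' z" using fun_cong[OF eq, of b] unfolding \<sigma>_def z_def by simp
    then show "f x y = f x' y"
      using same[OF x \<open>y \<in> Y b\<close> \<open>z \<in> Y b\<close>] same[OF x \<open>z \<in> Y b\<close> \<open>y \<in> Y b\<close>] by (cases "y \<le> z") auto
  qed
  have mem: "(SOME x. x \<in> X) \<in> X" "(SOME x. x \<in> X) < n" "r (SOME x. x \<in> X) = i"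
      "X = row_equiv f n m r c `` {SOME x. x \<in> X}" if "X \<in> Q" for X
  proof -
    have X: "X \<in> {..<n} // row_equiv f n m r c" "X \<subseteq> {x. r x = i}" using that unfolding Q_def by auto
    have "X \<noteq> {}" using X(1) equiv_row_equiv in_quotient_imp_non_empty by blast
    then show *: "(SOME x. x \<in> X) \<in> X" by (simp add: some_in_eq)
    then show "r (SOME x. x \<in> X) = i" using X(2) by blast
    have "X \<subseteq> {..<n}" using X(1) equiv_row_equiv in_quotient_imp_subset by blast
    then show "(SOME x. x \<in> X) < n" using * by blast
    show "X = row_equiv f n m r c `` {SOME x. x \<in> X}"
      using X(1)
    proof (rule quotientE)
      fix z assume z: "X = row_equiv f n m r c `` {z}"
      then have "(z, SOME x. x \<in> X) \<in> row_equiv f n m r c" using * by blast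
      then show ?thesis using z equiv_class_eq[OF equiv_row_equiv] by metis
    qed
  qed
  have "inj_on (\<lambda>X. \<sigma> (SOME x. x \<in> X)) Q"
  proof (rule inj_onI)
    fix X X' assume X: "X \<in> Q" "X' \<in> Q" "\<sigma> (SOME x. x \<in> X) = \<sigma> (SOME x. x \<in> X')"
    then have "(SOME x. x \<in> X, SOME x. x \<in> X') \<in> row_equiv f n m r c"
      by (intro \<sigma>) (use mem in auto)
    then show "X = X'" using mem(4)[OF X(1)] mem(4)[OF X(2)] equiv_class_eq[OF equiv_row_equiv] by metis
  qed
  moreover have "(\<lambda>X. \<sigma> (SOME x. x \<in> X)) ` Q \<subseteq> {..K} \<rightarrow>\<^sub>E A"
  proof
    fix s assume "s \<in> (\<lambda>X. \<sigma> (SOME x. x \<in> X)) ` Q"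
    then obtain X where "X \<in> Q" "s = \<sigma> (SOME x. x \<in> X)" by blast
    moreover have "(SOME y. y \<in> Y b) < m" if "Y b \<noteq> {}" for b
      using that some_in_eq[of "Y b"] unfolding Y_def by auto
    ultimately show "s \<in> {..K} \<rightarrow>\<^sub>E A"
      unfolding \<sigma>_def using \<open>a \<in> A\<close> A(3) mem(2) by auto
  qed
  ultimately have "card Q \<le> card ({..K} \<rightarrow>\<^sub>E A)"
    by (rule card_inj_on_le) (use A in \<open>simp add: finite_PiE\<close>)
  then show ?thesis unfolding Q_def by (simp add: card_PiE)
qed

section \<open>Pairwise merges between nested partitions\<close>

lemma refines_quotient:
  assumes "equiv A R" "equiv A S" "R \<subseteq> S"
  shows "refines A (A // R) (A // S)"
  unfolding refines_def
proof (intro conjI partition_on_quotient assms ballI)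
  show "\<exists>Y\<in>A // S. X \<subseteq> Y" if "X \<in> A // R" for X
    using that assms(3) by (auto simp: quotient_def)
qed

lemma partition_on_merge:
  assumes P: "partition_on A P" and XY: "X \<in> P" "Y \<in> P" "X \<noteq> Y"
  defines "Q \<equiv> insert (X \<union> Y) (P - {X, Y})"
  shows "refines A P Q" and "finite A \<Longrightarrow> Suc (card Q) = card P"
proof -
  have dis: "X \<inter> Z = {}" "Y \<inter> Z = {}" if "Z \<in> P - {X, Y}" for Z
    using that XY disjointD[OF partition_onD2[OF P]] by blast+
  have ne: "X \<noteq> {}" "Y \<noteq> {}" using XY partition_onD3[OF P] by auto
  have "partition_on A Q"
  proof (rule partition_onI)
    show "\<Union>Q = A" unfolding Q_def using XY partition_onD1[OF P] by auto
    show "{} \<notin> Q" unfolding Q_def using ne partition_onD3[OF P] by auto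
    have un: "(X \<union> Y) \<inter> Z = {}" if "Z \<in> P - {X, Y}" for Z
      using dis[OF that] by (simp add: Int_Un_distrib2)
    fix p q assume pq: "p \<in> Q" "q \<in> Q" "p \<noteq> q"
    show "disjnt p q"
    proof (cases "p = X \<union> Y \<or> q = X \<union> Y")
      case True
      then have "p = X \<union> Y \<and> q \<in> P - {X, Y} \<or> q = X \<union> Y \<and> p \<in> P - {X, Y}"
        using pq insertE[of p] insertE[of q] unfolding Q_def by metis
      then show ?thesis unfolding disjnt_def
        using un[of p] un[of q] by (elim disjE conjE) (simp_all only: Int_commute[of p "X \<union> Y"])
    next
      case False
      then have "p \<in> P" "q \<in> P" using pq unfolding Q_def by simp_all
      then show ?thesis using disjointD[OF partition_onD2[OF P]] pq(3) unfolding disjnt_def by simp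
    qed
  qed
  moreover have "\<exists>W\<in>Q. Z \<subseteq> W" if "Z \<in> P" for Z
  proof (cases "Z = X \<or> Z = Y")
    case True
    then show ?thesis unfolding Q_def by (intro bexI[of _ "X \<union> Y"]) auto
  next
    case False
    then show ?thesis using that unfolding Q_def by (intro bexI[of _ Z]) auto
  qed
  ultimately show "refines A P Q" unfolding refines_def using P by simp
  assume "finite A"
  then have "finite P" using P by (metis finite_UnionD partition_onD1)
  have "X \<union> Y \<notin> P - {X, Y}"
  proof
    assume "X \<union> Y \<in> P - {X, Y}"
    then have "X \<inter> (X \<union> Y) = {}" using dis(1) by blast
    then show False using ne by blast
  qed
  then have "card Q = Suc (card (P - {X, Y}))" unfolding Q_def using \<open>finite P\<close> by simp
  moreover have "card (P - {X, Y}) = card P - card {X, Y}" "card {X, Y} \<le> card P"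
    using XY \<open>finite P\<close> by (simp add: card_Diff_subset, intro card_mono) auto
  moreover have "card {X, Y} = 2" using XY by simp
  ultimately show "Suc (card Q) = card P" by simp
qed

text \<open>As long as two parts lie in the same part of \<open>Q\<close> they can be merged; once
  none do, the partition equals \<open>Q\<close>. The lower bound \<open>P0\<close> stays fixed
  during the induction, so that every member of the path is known to lie between both ends.\<close>

lemma refines_merge_path:
  assumes "finite A" "refines A P0 P" "refines A P Q"
  shows "(\<lambda>U V. merge_two U V \<and> refines A P0 V \<and> refines A V Q)\<^sup>*\<^sup>* P Q"
  using assms(2,3)
proof (induction "card P" arbitrary: P rule: less_induct)
  case less
  have P: "partition_on A P" and Q: "partition_on A Q" using less.prems unfolding refines_def by auto
  show ?case
  proof (cases "\<exists>Z\<in>Q. \<exists>X\<in>P. \<exists>Y\<in>P. X \<noteq> Y \<and> X \<subseteq> Z \<and> Y \<subseteq> Z")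
    case True
    then obtain Z X Y where XY: "Z \<in> Q" "X \<in> P" "Y \<in> P" "X \<noteq> Y" "X \<subseteq> Z" "Y \<subseteq> Z" by blast
    define P' where "P' = insert (X \<union> Y) (P - {X, Y})"
    have ref: "refines A P P'" and card: "Suc (card P') = card P"
      unfolding P'_def using partition_on_merge[OF P XY(2-4)] \<open>finite A\<close> by auto
    have "refines A P' Q"
      using ref less.prems(2) XY unfolding refines_def P'_def by auto
    have "refines A P0 P'" using less.prems(1) ref by (rule refines_trans)
    have "(\<lambda>U V. merge_two U V \<and> refines A P0 V \<and> refines A V Q)\<^sup>*\<^sup>* P' Q"
      using less.hyps[OF _ \<open>refines A P0 P'\<close> \<open>refines A P' Q\<close>] card by simp
    moreover have "merge_two P P'" unfolding merge_two_def P'_def using XY by blast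
    ultimately show ?thesis
      using \<open>refines A P0 P'\<close> \<open>refines A P' Q\<close> by (simp add: converse_rtranclp_into_rtranclp)
  next
    case False
    have "\<exists>X\<in>P. Z \<subseteq> X" if "Z \<in> Q" for Z
    proof -
      have "Z \<noteq> {}" using that partition_onD3[OF Q] by auto
      have sub: "\<exists>X\<in>P. z \<in> X \<and> X \<subseteq> Z" if "z \<in> Z" for z
      proof -
        have "z \<in> A" using that \<open>Z \<in> Q\<close> partition_onD1[OF Q] by blast
        then obtain X where X: "X \<in> P" "z \<in> X" using partition_onD1[OF P] by blast
        then obtain Z' where "Z' \<in> Q" "X \<subseteq> Z'" using less.prems(2) unfolding refines_def by blast
        then have "Z' = Z"
          using X that \<open>Z \<in> Q\<close> disjointD[OF partition_onD2[OF Q], of Z' Z] by blast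
        then show ?thesis using X \<open>X \<subseteq> Z'\<close> by blast
      qed
      obtain z where "z \<in> Z" using \<open>Z \<noteq> {}\<close> by blast
      then obtain X where X: "X \<in> P" "X \<subseteq> Z" using sub by blast
      have "Z \<subseteq> X"
      proof
        fix z' assume "z' \<in> Z"
        then obtain X' where "X' \<in> P" "z' \<in> X'" "X' \<subseteq> Z" using sub by blast
        then show "z' \<in> X" using False X that by blast
      qed
      then show ?thesis using X by blast
    qed
    then have "refines A Q P" using P Q unfolding refines_def by blast
    then have "P = Q" using less.prems(2) refines_asym by blast
    then show ?thesis by simp
  qed
qed

text \<open>Stated for entry functions, so that rows and columns can be exchanged and no positions
  inside a submatrix occur.\<close>

definition nonconstant_on :: "('b \<Rightarrow> 'c \<Rightarrow> 'a) \<Rightarrow> 'b set \<Rightarrow> 'c set \<Rightarrow> bool" where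
  "nonconstant_on f X Y \<longleftrightarrow> (\<exists>x\<in>X. \<exists>x'\<in>X. \<exists>y\<in>Y. \<exists>y'\<in>Y. f x y \<noteq> f x' y')"

text \<open>Every counted part of \<open>V\<close> contains a whole class of the old labels, and by
  \<open>h\<close> the label \<open>l\<close> stems from at most two of these. Choosing one class in
  each part is injective, whence the factor 2.\<close>

lemma card_parts_in_label:
  assumes A: "finite A" "A \<noteq> {}" "\<And>x y. x < n \<Longrightarrow> y < m \<Longrightarrow> f x y \<in> A"
    and r: "mono r" and c: "mono c"
    and K: "\<And>j. mixed_value ((corners f n m)\<inverse>) c r j \<le> K"
    and h: "\<And>j. j = h j \<or> j = Suc (h j)"
    and V: "refines {..<m} ({..<m} // col_equiv f n m r c) V"
  shows "card {Y \<in> V. Y \<subseteq> {y. h (c y) = l}} \<le> 2 * card A ^ Suc K"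
proof -
  define P where "P = {..<m} // col_equiv f n m r c"
  define S where "S j = {Z \<in> P. Z \<subseteq> {y. c y = j}}" for j
  have S: "card (S j) \<le> card A ^ Suc K" for j
    unfolding S_def P_def
    by (rule card_row_classes) (use A r c K in \<open>auto simp: corners_converse\<close>)
  have pV: "partition_on {..<m} V" and pP: "partition_on {..<m} P"
    and ref: "\<And>Z. Z \<in> P \<Longrightarrow> \<exists>Y\<in>V. Z \<subseteq> Y" using V unfolding refines_def P_def by auto
  have "finite P" using pP by (metis finite_UnionD finite_lessThan partition_onD1)
  then have finS: "finite (S j)" for j unfolding S_def by simp
  have "\<exists>Z. Z \<in> S l \<union> S (Suc l) \<and> Z \<subseteq> Y \<and> Z \<noteq> {}" if Y: "Y \<in> V" "Y \<subseteq> {y. h (c y) = l}" for Y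
  proof -
    have "Y \<noteq> {}" using Y partition_onD3[OF pV] by auto
    then obtain y where "y \<in> Y" by blast
    then have "y < m" using Y partition_onD1[OF pV] by blast
    define Z where "Z = col_equiv f n m r c `` {y}"
    have "Z \<in> P" unfolding Z_def P_def using \<open>y < m\<close> by (simp add: quotientI)
    have "y \<in> Z" unfolding Z_def using \<open>y < m\<close> by (simp add: row_equiv_def)
    obtain Y' where "Y' \<in> V" "Z \<subseteq> Y'" using ref \<open>Z \<in> P\<close> by blast
    then have "Y' = Y" using \<open>y \<in> Z\<close> \<open>y \<in> Y\<close> \<open>Y' \<in> V\<close> \<open>Z \<subseteq> Y'\<close> Y
      disjointD[OF partition_onD2[OF pV], of Y' Y] by blast
    have "Z \<subseteq> {z. c z = c y}" unfolding Z_def row_equiv_def by auto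
    then have "Z \<in> S (c y)" unfolding S_def using \<open>Z \<in> P\<close> by blast
    moreover have "c y = l \<or> c y = Suc l" using h[of "c y"] Y \<open>y \<in> Y\<close> by auto
    ultimately show ?thesis using \<open>Y' = Y\<close> \<open>Z \<subseteq> Y'\<close> \<open>y \<in> Z\<close> by auto
  qed
  then obtain \<phi> where \<phi>: "\<And>Y. Y \<in> V \<Longrightarrow> Y \<subseteq> {y. h (c y) = l} \<Longrightarrow>
      \<phi> Y \<in> S l \<union> S (Suc l) \<and> \<phi> Y \<subseteq> Y \<and> \<phi> Y \<noteq> {}" by metis
  have "inj_on \<phi> {Y \<in> V. Y \<subseteq> {y. h (c y) = l}}"
  proof (rule inj_onI)
    fix Y Y' assume Y: "Y \<in> {Y \<in> V. Y \<subseteq> {y. h (c y) = l}}" "Y' \<in> {Y \<in> V. Y \<subseteq> {y. h (c y) = l}}" "\<phi> Y = \<phi> Y'"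
    then have "Y \<inter> Y' \<noteq> {}" using \<phi>[of Y] \<phi>[of Y'] by auto
    then show "Y = Y'" using Y disjointD[OF partition_onD2[OF pV], of Y Y'] by blast
  qed
  then have "card {Y \<in> V. Y \<subseteq> {y. h (c y) = l}} \<le> card (S l \<union> S (Suc l))"
    by (rule card_inj_on_le) (use \<phi> finS in auto)
  also have "\<dots> \<le> card (S l) + card (S (Suc l))" by (rule card_Un_le)
  also have "\<dots> \<le> 2 * card A ^ Suc K" using S[of l] S[of "Suc l"] by linarith
  finally show ?thesis .
qed

text \<open>Here \<open>U\<close> and \<open>V\<close> are the partitions met while passing from the labels \<open>r, c\<close> to the merged labels
  \<open>g \<circ> r, h \<circ> c\<close>.\<close>

lemma row_error_bound:
  assumes A: "finite A" "A \<noteq> {}" "\<And>x y. x < n \<Longrightarrow> y < m \<Longrightarrow> f x y \<in> A"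
    and r: "mono r" and c: "mono c"
    and K: "\<And>j. mixed_value ((corners f n m)\<inverse>) c r j \<le> K"
    and K': "\<And>i. mixed_value (corners f n m) (g \<circ> r) (h \<circ> c) i \<le> K"
    and h: "\<And>j. j = h j \<or> j = Suc (h j)"
    and U: "refines {..<n} U ({..<n} // row_equiv f n m (g \<circ> r) (h \<circ> c))"
    and V: "refines {..<m} ({..<m} // col_equiv f n m r c) V"
    and V': "refines {..<m} V ({..<m} // col_equiv f n m (g \<circ> r) (h \<circ> c))"
    and X: "X \<in> U"
  shows "card {Y \<in> V. nonconstant_on f X Y} \<le> 2 * K * card A ^ Suc K"
proof -
  define E where "E = corners f n m"
  define r' where "r' = g \<circ> r"
  define c' where "c' = h \<circ> c"
  have pV: "partition_on {..<m} V" using V unfolding refines_def by auto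
  have "finite V" using pV by (metis finite_UnionD finite_lessThan partition_onD1)
  obtain x0 where "X \<subseteq> row_equiv f n m r' c' `` {x0}"
    using U X unfolding refines_def r'_def c'_def quotient_def by blast
  then have X: "(x0, x) \<in> row_equiv f n m r' c'" if "x \<in> X" for x using that by blast
  define J where "J = {j. mixed_zone E r' c' (r' x0) j}"
  have "finite J" "card J \<le> K"
    using card_mixed_zones[of E r' c' "r' x0"] K'[of "r' x0"] finite_corners
    unfolding J_def E_def r'_def c'_def by (auto intro: order_trans)
  have "{Y \<in> V. nonconstant_on f X Y} \<subseteq> (\<Union>j\<in>J. {Y \<in> V. Y \<subseteq> {y. h (c y) = j}})"
  proof
    fix Y assume "Y \<in> {Y \<in> V. nonconstant_on f X Y}"
    then have Y: "Y \<in> V" and nc: "nonconstant_on f X Y" by auto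
    obtain y0 where "Y \<subseteq> col_equiv f n m r' c' `` {y0}"
      using V' Y unfolding refines_def r'_def c'_def quotient_def by blast
    then have Y0: "(y0, y) \<in> col_equiv f n m r' c'" if "y \<in> Y" for y using that by blast
    have "c' y0 \<in> J"
    proof (rule ccontr)
      assume "c' y0 \<notin> J"
      then have nm: "\<not> mixed_zone E r' c' (r' x0) (c' y0)" unfolding J_def by simp
      \<comment> \<open>Both sets lie in classes of the merged labels, which agree off the mixed
        zones: \<open>x\<close> is moved to \<open>x0\<close> within column \<open>y\<close>, then
        \<open>y\<close> to \<open>y0\<close> within row \<open>x0\<close>.\<close>
      have "f x y = f x0 y0" if "x \<in> X" "y \<in> Y" for x y
      proof -
        have "f x0 y = f x y"
          using X[OF that(1)] Y0[OF that(2)] nm unfolding row_equiv_def E_def by auto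
        moreover have "f x0 y0 = f x0 y"
          using X[OF that(1)] Y0[OF that(2)] nm unfolding col_equiv_iff E_def
          by (auto simp: row_equiv_def)
        ultimately show ?thesis by simp
      qed
      then show False using nc unfolding nonconstant_on_def by metis
    qed
    moreover have "Y \<subseteq> {y. h (c y) = c' y0}" using Y0 unfolding row_equiv_def c'_def by auto
    ultimately show "Y \<in> (\<Union>j\<in>J. {Y \<in> V. Y \<subseteq> {y. h (c y) = j}})" using Y by blast
  qed
  then have "card {Y \<in> V. nonconstant_on f X Y} \<le> card (\<Union>j\<in>J. {Y \<in> V. Y \<subseteq> {y. h (c y) = j}})"
    using \<open>finite J\<close> \<open>finite V\<close> by (intro card_mono) auto
  also have "\<dots> \<le> (\<Sum>j\<in>J. card {Y \<in> V. Y \<subseteq> {y. h (c y) = j}})"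
    using \<open>finite J\<close> by (rule card_UN_le)
  also have "\<dots> \<le> (\<Sum>j\<in>J. 2 * card A ^ Suc K)"
    by (intro sum_mono card_parts_in_label[OF A r c K h V])
  also have "\<dots> = card J * (2 * card A ^ Suc K)" by simp
  also have "\<dots> \<le> K * (2 * card A ^ Suc K)" using \<open>card J \<le> K\<close> by (rule mult_le_mono1)
  finally show ?thesis by (simp add: mult_ac)
qed

section \<open>Submatrices and partitions of a matrix\<close>

abbreviation entry :: "'a mat \<Rightarrow> nat \<Rightarrow> nat \<Rightarrow> 'a" where
  "entry M \<equiv> \<lambda>x y. M $$ (x, y)"

lemma submatrix_position:
  assumes "X \<subseteq> {..<dim_row M}" "Y \<subseteq> {..<dim_col M}" "x \<in> X" "y \<in> Y"
  shows "\<exists>i j. i < dim_row (submatrix M X Y) \<and> j < dim_col (submatrix M X Y) \<and>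
    submatrix M X Y $$ (i, j) = M $$ (x, y)"
proof (intro exI conjI)
  have pos: "card {a \<in> Z. a < z} < card {i. i < k \<and> i \<in> Z}" if "Z \<subseteq> {..<k}" "z \<in> Z" for Z z and k :: nat
    using that by (intro psubset_card_mono) auto
  show "card {a \<in> X. a < x} < dim_row (submatrix M X Y)" "card {a \<in> Y. a < y} < dim_col (submatrix M X Y)"
    using pos assms by (simp_all add: dim_submatrix)
  show "submatrix M X Y $$ (card {a \<in> X. a < x}, card {a \<in> Y. a < y}) = M $$ (x, y)"
    by (rule submatrix_index_card) (use assms in auto)
qed

lemma submatrix_pick:
  assumes "X \<subseteq> {..<dim_row M}" "Y \<subseteq> {..<dim_col M}"
    and "i < dim_row (submatrix M X Y)" "j < dim_col (submatrix M X Y)"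
  shows "pick X i \<in> X" "pick Y j \<in> Y" "submatrix M X Y $$ (i, j) = M $$ (pick X i, pick Y j)"
proof -
  have "{i. i < dim_row M \<and> i \<in> X} = X" "{j. j < dim_col M \<and> j \<in> Y} = Y" using assms by auto
  then show "pick X i \<in> X" "pick Y j \<in> Y"
    using assms(3,4) by (auto simp: dim_submatrix intro: pick_in_set_le)
  show "submatrix M X Y $$ (i, j) = M $$ (pick X i, pick Y j)"
    by (rule submatrix_index) (use assms(3,4) in \<open>simp_all add: dim_submatrix\<close>)
qed

lemma constant_submatrix_iff:
  assumes "X \<subseteq> {..<dim_row M}" "Y \<subseteq> {..<dim_col M}"
  shows "constant_mat (submatrix M X Y) \<longleftrightarrow> \<not> nonconstant_on (entry M) X Y"
proof
  assume const: "constant_mat (submatrix M X Y)"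
  show "\<not> nonconstant_on (entry M) X Y"
    unfolding nonconstant_on_def
  proof clarsimp
    fix x x' y y' assume xy: "x \<in> X" "x' \<in> X" "y \<in> Y" "y' \<in> Y"
    show "M $$ (x, y) = M $$ (x', y')"
      using submatrix_position[OF assms xy(1,3)] submatrix_position[OF assms xy(2,4)] const
      unfolding constant_mat_def by metis
  qed
next
  assume "\<not> nonconstant_on (entry M) X Y"
  then show "constant_mat (submatrix M X Y)"
    unfolding nonconstant_on_def constant_mat_def using submatrix_pick[OF assms] by metis
qed

lemma not_vertical_submatrix:
  assumes "X \<subseteq> {..<dim_row M}" "Y \<subseteq> {..<dim_col M}" "\<not> vertical_mat (submatrix M X Y)"
  shows "\<exists>y\<in>Y. \<exists>x\<in>X. \<exists>x'\<in>X. M $$ (x, y) \<noteq> M $$ (x', y)"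
proof -
  obtain i j where ij: "Suc i < dim_row (submatrix M X Y)" "j < dim_col (submatrix M X Y)"
    "submatrix M X Y $$ (i, j) \<noteq> submatrix M X Y $$ (Suc i, j)"
    using assms(3) unfolding vertical_mat_def by blast
  then show ?thesis
    using submatrix_pick[OF assms(1,2) _ ij(2), of i] submatrix_pick[OF assms(1,2) _ ij(2), of "Suc i"]
    by (metis Suc_lessD)
qed

lemma not_horizontal_submatrix:
  assumes "X \<subseteq> {..<dim_row M}" "Y \<subseteq> {..<dim_col M}" "\<not> horizontal_mat (submatrix M X Y)"
  shows "\<exists>x\<in>X. \<exists>y\<in>Y. \<exists>y'\<in>Y. M $$ (x, y) \<noteq> M $$ (x, y')"
proof -
  obtain i j where ij: "i < dim_row (submatrix M X Y)" "Suc j < dim_col (submatrix M X Y)"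
    "submatrix M X Y $$ (i, j) \<noteq> submatrix M X Y $$ (i, Suc j)"
    using assms(3) unfolding horizontal_mat_def by blast
  then show ?thesis
    using submatrix_pick[OF assms(1,2) ij(1), of j] submatrix_pick[OF assms(1,2) ij(1), of "Suc j"]
    by (metis Suc_lessD)
qed

lemma submatrix_interval:
  assumes "b \<le> dim_row M" "d \<le> dim_col M" "i < b - a" "j < d - c"
  shows "submatrix M {a..<b} {c..<d} $$ (i, j) = M $$ (a + i, c + j)"
proof -
  have pos: "card {u \<in> {a..<b}. u < a + i} = i" if "i < b - a" for a b i :: nat
  proof -
    have "{u \<in> {a..<b}. u < a + i} = {a..<a + i}" using that by auto
    then show ?thesis by simp
  qed
  show ?thesis
    using submatrix_index_card[of "a + i" M "c + j" "{a..<b}" "{c..<d}"] assms pos[of i b a] pos[of j d c] by simp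
qed

lemma mixed_submatrix_corner:
  assumes "b \<le> dim_row M" "d \<le> dim_col M"
    and "a \<le> x" "Suc x < b" "c \<le> y" "Suc y < d"
    and corner: "(x, y) \<in> corners (entry M) (dim_row M) (dim_col M)"
  shows "mixed_mat (submatrix M {a..<b} {c..<d})"
proof -
  let ?S = "submatrix M {a..<b} {c..<d}"
  have "{i. i < dim_row M \<and> i \<in> {a..<b}} = {a..<b}" "{j. j < dim_col M \<and> j \<in> {c..<d}} = {c..<d}"
    using assms(1,2) by auto
  then have dim: "dim_row ?S = b - a" "dim_col ?S = d - c" by (simp_all add: dim_submatrix)
  define i where "i = x - a"
  define j where "j = y - c"
  have ij: "Suc i < b - a" "Suc j < d - c" "x = a + i" "y = c + j"
    using assms(3-6) unfolding i_def j_def by auto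
  have S: "?S $$ (i', j') = M $$ (a + i', c + j')" if "i' \<in> {i, Suc i}" "j' \<in> {j, Suc j}" for i' j'
    using that ij by (intro submatrix_interval assms(1,2)) auto
  have c1: "\<not> (M $$ (x, y) = M $$ (Suc x, y) \<and> M $$ (x, Suc y) = M $$ (Suc x, Suc y))"
    and c2: "\<not> (M $$ (x, y) = M $$ (x, Suc y) \<and> M $$ (Suc x, y) = M $$ (Suc x, Suc y))"
    using corner unfolding corners_def by auto
  have "\<not> vertical_mat ?S"
  proof
    assume "vertical_mat ?S"
    then have "?S $$ (i, j') = ?S $$ (Suc i, j')" if "j' \<in> {j, Suc j}" for j'
      using that ij(1,2) dim unfolding vertical_mat_def by auto
    then have "M $$ (a + i, c + j') = M $$ (a + Suc i, c + j')" if "j' \<in> {j, Suc j}" for j'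
      using that S by simp
    from this[of j] this[of "Suc j"] show False using c1 ij(3,4) by simp
  qed
  moreover have "\<not> horizontal_mat ?S"
  proof
    assume "horizontal_mat ?S"
    then have "?S $$ (i', j) = ?S $$ (i', Suc j)" if "i' \<in> {i, Suc i}" for i'
      using that ij(1,2) dim unfolding horizontal_mat_def by auto
    then have "M $$ (a + i', c + j) = M $$ (a + i', c + Suc j)" if "i' \<in> {i, Suc i}" for i'
      using that S by simp
    from this[of i] this[of "Suc i"] show False using c2 ij(3,4) by simp
  qed
  ultimately show ?thesis unfolding mixed_mat_def by blast
qed

lemma mono_fibre_interval:
  fixes \<rho> :: "nat \<Rightarrow> nat"
  assumes "mono \<rho>"
  shows "\<exists>a b. {x. x < n \<and> \<rho> x = i} = {a..<b}"
proof (cases "{x. x < n \<and> \<rho> x = i} = {}")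
  case False
  let ?S = "{x. x < n \<and> \<rho> x = i}"
  have fin: "finite ?S" by simp
  have lo: "Min ?S \<in> ?S" and hi: "Max ?S \<in> ?S" using False fin by (metis Min_in, metis Max_in)
  have "?S = {Min ?S..<Suc (Max ?S)}"
  proof
    show "?S \<subseteq> {Min ?S..<Suc (Max ?S)}" by (auto simp: less_Suc_eq_le)
    show "{Min ?S..<Suc (Max ?S)} \<subseteq> ?S"
    proof
      fix x assume "x \<in> {Min ?S..<Suc (Max ?S)}"
      then have x: "Min ?S \<le> x" "x \<le> Max ?S" by auto
      have "\<rho> (Min ?S) \<le> \<rho> x" "\<rho> x \<le> \<rho> (Max ?S)" using x assms by (simp_all add: monoD)
      then show "x \<in> ?S" using lo hi x by auto
    qed
  qed
  then show ?thesis by blast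
next
  case True
  then show ?thesis by (intro exI[of _ 0]) simp
qed

lemma mono_fibres_partition:
  fixes \<rho> :: "nat \<Rightarrow> nat"
  assumes "\<And>i. i < k \<Longrightarrow> \<exists>x<n. \<rho> x = i" "\<And>x. \<rho> x < k"
  defines "P \<equiv> (\<lambda>i. {x. x < n \<and> \<rho> x = i}) ` {..<k}"
  shows "partition_on {..<n} P" "card P = k"
proof -
  show "partition_on {..<n} P"
  proof (rule partition_onI)
    show "\<Union>P = {..<n}" unfolding P_def using assms(2) by auto
    show "{} \<notin> P" unfolding P_def using assms(1) by auto
    show "disjnt p q" if "p \<in> P" "q \<in> P" "p \<noteq> q" for p q
      using that unfolding P_def disjnt_def by auto
  qed
  have "inj_on (\<lambda>i. {x. x < n \<and> \<rho> x = i}) {..<k}"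
  proof (rule inj_onI)
    fix i j assume "i \<in> {..<k}" "{x. x < n \<and> \<rho> x = i} = {x. x < n \<and> \<rho> x = j}"
    then show "i = j" using assms(1)[of i] by auto
  qed
  then show "card P = k" unfolding P_def by (simp add: card_image)
qed

text \<open>The fibres of monotone maps are intervals, and the corner in each cell both shows that
  its fibres are nonempty and makes the zone mixed.\<close>

lemma mixed_minor_of_corner_minor:
  assumes "corner_minor k (corners (entry M) (dim_row M) (dim_col M))" "1 \<le> k"
  shows "\<exists>P. mixed_minor k M P"
proof -
  define E where "E = corners (entry M) (dim_row M) (dim_col M)"
  have E: "Suc x < dim_row M \<and> Suc y < dim_col M" if "(x, y) \<in> E" for x y
    using that unfolding E_def corners_def by auto
  obtain \<rho> \<chi> :: "nat \<Rightarrow> nat" where m: "mono \<rho>" "mono \<chi>" and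
    minor: "\<And>i j. i < k \<Longrightarrow> j < k \<Longrightarrow>
      \<exists>x y. (x, y) \<in> E \<and> \<rho> x = i \<and> \<rho> (Suc x) = i \<and> \<chi> y = j \<and> \<chi> (Suc y) = j"
    using assms unfolding corner_minor_def E_def by blast
  \<comment> \<open>Truncation at \<open>k - 1\<close> lets the last part absorb all larger values,
    so that there are exactly \<open>k\<close> fibres.\<close>
  define \<rho>' where "\<rho>' x = min (\<rho> x) (k - 1)" for x
  define \<chi>' where "\<chi>' y = min (\<chi> y) (k - 1)" for y
  have m': "mono \<rho>'" "mono \<chi>'"
    using m unfolding \<rho>'_def \<chi>'_def mono_def by (auto simp: min_le_iff_disj)
  have minor': "\<exists>x y. (x, y) \<in> E \<and> \<rho>' x = i \<and> \<rho>' (Suc x) = i \<and> \<chi>' y = j \<and> \<chi>' (Suc y) = j"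
    if ij: "i < k" "j < k" for i j
  proof -
    obtain x y where "(x, y) \<in> E" "\<rho> x = i" "\<rho> (Suc x) = i" "\<chi> y = j" "\<chi> (Suc y) = j"
      using minor[OF ij] by blast
    then show ?thesis using ij unfolding \<rho>'_def \<chi>'_def by (intro exI[of _ x] exI[of _ y]) simp
  qed
  define fr where "fr i = {x. x < dim_row M \<and> \<rho>' x = i}" for i
  define fc where "fc j = {y. y < dim_col M \<and> \<chi>' y = j}" for j
  have bd: "\<rho>' x < k" "\<chi>' x < k" for x using \<open>1 \<le> k\<close> unfolding \<rho>'_def \<chi>'_def by auto
  have sur: "\<exists>x<dim_row M. \<rho>' x = i" "\<exists>y<dim_col M. \<chi>' y = i" if "i < k" for i
    using minor'[OF that that] E by (meson Suc_lessD)+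
  have R: "partition_on {..<dim_row M} (fr ` {..<k})" "card (fr ` {..<k}) = k"
    and C: "partition_on {..<dim_col M} (fc ` {..<k})" "card (fc ` {..<k}) = k"
    unfolding fr_def fc_def using mono_fibres_partition sur bd by blast+
  have int: "\<exists>a b. fr i = {a..<b}" "\<exists>a b. fc i = {a..<b}" for i
    unfolding fr_def fc_def using m' mono_fibre_interval by blast+
  have "kl_division k k M (fr ` {..<k}, fc ` {..<k})"
    unfolding kl_division_def mat_division_def mat_partition_def using R C int by auto
  moreover have "mixed_mat (submatrix M (fr i) (fc j))" if ij: "i < k" "j < k" for i j
  proof -
    obtain a b c d where abcd: "fr i = {a..<b}" "fc j = {c..<d}" using int by meson
    obtain x y where xy: "(x, y) \<in> E" "\<rho>' x = i" "\<rho>' (Suc x) = i" "\<chi>' y = j" "\<chi>' (Suc y) = j"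
      using minor'[OF ij] by blast
    have "x \<in> fr i" "Suc x \<in> fr i" "y \<in> fc j" "Suc y \<in> fc j"
      using xy E[OF xy(1)] unfolding fr_def fc_def by auto
    then have xs: "a \<le> x" "Suc x < b" "c \<le> y" "Suc y < d" unfolding abcd by auto
    then have "b - 1 \<in> fr i" "d - 1 \<in> fc j" unfolding abcd by auto
    then have "b - 1 < dim_row M" "d - 1 < dim_col M" unfolding fr_def fc_def by auto
    then have "b \<le> dim_row M" "d \<le> dim_col M" by linarith+
    then show ?thesis
      unfolding abcd using xs xy(1) unfolding E_def by (rule mixed_submatrix_corner)
  qed
  ultimately show ?thesis unfolding mixed_minor_def by (intro exI[of _ "(fr ` {..<k}, fc ` {..<k})"]) auto
qed

lemma nonconstant_on_swap: "nonconstant_on (\<lambda>x y. f y x) Y X \<longleftrightarrow> nonconstant_on f X Y"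
  unfolding nonconstant_on_def by blast

text \<open>As there is a row, the maximum runs over a nonempty finite set and can be bounded part
  by part.\<close>

lemma error_value_le_iff:
  assumes "mat_partition M (U, V)" "0 < dim_row M"
  shows "error_value M (U, V) \<le> B \<longleftrightarrow>
    (\<forall>X\<in>U. card {Y \<in> V. nonconstant_on (entry M) X Y} \<le> B) \<and>
    (\<forall>Y\<in>V. card {X \<in> U. nonconstant_on (entry M) X Y} \<le> B)"
proof -
  have p: "partition_on {..<dim_row M} U" "partition_on {..<dim_col M} V"
    using assms(1) unfolding mat_partition_def by auto
  have sub: "X \<subseteq> {..<dim_row M}" "Y \<subseteq> {..<dim_col M}" if "X \<in> U" "Y \<in> V" for X Y
    using that unfolding partition_onD1[OF p(1)] partition_onD1[OF p(2)] by (simp_all add: Union_upper)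
  have "finite U" "finite V" using p by (metis finite_UnionD finite_lessThan partition_onD1)+
  have "U \<noteq> {}"
  proof
    assume "U = {}"
    then have "{..<dim_row M} = {}" using partition_onD1[OF p(1)] by simp
    then show False using assms(2) by blast
  qed
  have "{Y \<in> V. \<not> constant_mat (submatrix M X Y)} = {Y \<in> V. nonconstant_on (entry M) X Y}" if "X \<in> U" for X
    using constant_submatrix_iff[OF sub[OF that]] by (intro Collect_cong conj_cong) simp_all
  moreover have "{X \<in> U. \<not> constant_mat (submatrix M X Y)} = {X \<in> U. nonconstant_on (entry M) X Y}" if "Y \<in> V" for Y
    using constant_submatrix_iff[OF sub[OF _ that]] by (intro Collect_cong conj_cong) simp_all
  ultimately show ?thesis
    unfolding error_value_def row_error_def col_error_def
    using \<open>finite U\<close> \<open>finite V\<close> \<open>U \<noteq> {}\<close> by (subst Max_le_iff) auto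
qed

section \<open>Merging paths of bounded error\<close>

definition good_partition :: "'a mat \<Rightarrow> nat \<Rightarrow> mat_part \<Rightarrow> bool" where
  "good_partition M B P \<longleftrightarrow> mat_partition M P \<and> error_value M P \<le> B"

abbreviation good_step :: "'a mat \<Rightarrow> nat \<Rightarrow> mat_part \<Rightarrow> mat_part \<Rightarrow> bool" where
  "good_step M B \<equiv> \<lambda>P Q. contraction_step P Q \<and> good_partition M B Q"

text \<open>All row merges are made with the columns at rest, then all column merges. Each pair on
  the way lies between the two ends, where \<open>good\<close> applies.\<close>

lemma good_path_between:
  assumes R: "refines {..<dim_row M} R R'" and C: "refines {..<dim_col M} C C'"
    and good: "\<And>U V. refines {..<dim_row M} R U \<Longrightarrow> refines {..<dim_row M} U R' \<Longrightarrow>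
      refines {..<dim_col M} C V \<Longrightarrow> refines {..<dim_col M} V C' \<Longrightarrow> good_partition M B (U, V)"
  shows "(good_step M B)\<^sup>*\<^sup>* (R, C) (R', C')"
proof -
  have refl: "refines {..<dim_row M} R' R'" "refines {..<dim_row M} R R"
    "refines {..<dim_col M} C C"
    using R C unfolding refines_def by auto
  have "(\<lambda>U V. merge_two U V \<and> refines {..<dim_row M} R V \<and> refines {..<dim_row M} V R')\<^sup>*\<^sup>* R R'"
    using refines_merge_path[OF _ refl(2) R] by simp
  then have "(good_step M B)\<^sup>*\<^sup>* (R, C) (R', C)"
  proof (induction rule: rtranclp_induct)
    case (step U V)
    have "contraction_step (U, C) (V, C)" using step.hyps(2) unfolding contraction_step_def by simp
    moreover have "good_partition M B (V, C)" using step.hyps(2) good refl C by blast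
    ultimately show ?case using step.IH by (simp add: rtranclp.rtrancl_into_rtrancl)
  qed simp
  moreover have "(\<lambda>U V. merge_two U V \<and> refines {..<dim_col M} C V \<and> refines {..<dim_col M} V C')\<^sup>*\<^sup>* C C'"
    using refines_merge_path[OF _ refl(3) C] by simp
  then have "(good_step M B)\<^sup>*\<^sup>* (R', C) (R', C')"
  proof (induction rule: rtranclp_induct)
    case (step U V)
    have "contraction_step (R', U) (R', V)" using step.hyps(2) unfolding contraction_step_def by simp
    moreover have "good_partition M B (R', V)" using step.hyps(2) good refl R by blast
    ultimately show ?case using step.IH by (simp add: rtranclp.rtrancl_into_rtrancl)
  qed simp
  ultimately show ?thesis by (rule rtranclp_trans)
qed

definition label_partition :: "'a mat \<Rightarrow> (nat \<Rightarrow> nat) \<Rightarrow> (nat \<Rightarrow> nat) \<Rightarrow> mat_part" where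
  "label_partition M r c =
    ({..<dim_row M} // row_equiv (entry M) (dim_row M) (dim_col M) r c,
     {..<dim_col M} // col_equiv (entry M) (dim_row M) (dim_col M) r c)"

lemma good_partition_between:
  fixes M :: "'a mat" and g h :: "nat \<Rightarrow> nat"
  defines "E \<equiv> corners (entry M) (dim_row M) (dim_col M)"
  assumes A: "finite A" "A \<noteq> {}" "elements_mat M \<subseteq> A" and M: "0 < dim_row M"
    and r: "mono r" and c: "mono c"
    and low: "low_mixed_values K E r c" "low_mixed_values K E (g \<circ> r) (h \<circ> c)"
    and g: "\<And>j. j = g j \<or> j = Suc (g j)" and h: "\<And>j. j = h j \<or> j = Suc (h j)"
    and U: "refines {..<dim_row M} (fst (label_partition M r c)) U"
      "refines {..<dim_row M} U (fst (label_partition M (g \<circ> r) (h \<circ> c)))"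
    and V: "refines {..<dim_col M} (snd (label_partition M r c)) V"
      "refines {..<dim_col M} V (snd (label_partition M (g \<circ> r) (h \<circ> c)))"
  shows "good_partition M (2 * K * card A ^ Suc K) (U, V)"
proof -
  have el: "M $$ (x, y) \<in> A" if "x < dim_row M" "y < dim_col M" for x y
    using that A(3) elements_matI[of M "dim_row M" "dim_col M" x y] by auto
  have el': "M $$ (y, x) \<in> A" if "x < dim_col M" "y < dim_row M" for x y
    using el that by blast
  have part: "mat_partition M (U, V)" using U V unfolding mat_partition_def refines_def by auto
  have low': "mixed_value E r c i \<le> K" "mixed_value (E\<inverse>) c r i \<le> K"
      "mixed_value E (g \<circ> r) (h \<circ> c) i \<le> K" "mixed_value (E\<inverse>) (h \<circ> c) (g \<circ> r) i \<le> K" for i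
    using low unfolding low_mixed_values_def by auto
  have "card {Y \<in> V. nonconstant_on (entry M) X Y} \<le> 2 * K * card A ^ Suc K" if "X \<in> U" for X
    by (rule row_error_bound[where n = "dim_row M" and m = "dim_col M" and f = "entry M" and g = g,
        OF A(1,2) el r c _ _ h _ _ _ that])
      (use low' U V in \<open>simp_all add: label_partition_def E_def\<close>)
  moreover have "card {X \<in> U. nonconstant_on (\<lambda>x y. M $$ (y, x)) Y X} \<le> 2 * K * card A ^ Suc K" if "Y \<in> V" for Y
    by (rule row_error_bound[where n = "dim_col M" and m = "dim_row M" and f = "\<lambda>x y. M $$ (y, x)"
          and g = h, OF A(1,2) el' c r _ _ g _ _ _ that])
      (use low' U V in \<open>simp_all add: label_partition_def E_def corners_converse\<close>)
  ultimately show ?thesis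
    unfolding good_partition_def
    using part M error_value_le_iff[OF part M] nonconstant_on_swap[of "entry M"] by simp
qed

section \<open>Contraction sequences\<close>

lemma parts_in_zero_label:
  assumes "\<And>y. y < m \<Longrightarrow> c y = 0" "refines {..<m} C V"
  shows "{Y \<in> V. Y \<subseteq> {y. c y = (0::nat)}} = V"
proof -
  have "\<Union>V = {..<m}" using assms(2) unfolding refines_def by (metis partition_onD1)
  then show ?thesis using assms(1) by auto
qed

text \<open>Induction on the labels left. \<open>exists_merge\<close> supplies a merge of labels,
  and \<open>good_partition_between\<close> bounds the error on the way to the coarser
  refinement.\<close>

lemma contraction_path:
  fixes M :: "'a mat"
  defines "E \<equiv> corners (entry M) (dim_row M) (dim_col M)"
  assumes A: "finite A" "A \<noteq> {}" "elements_mat M \<subseteq> A" and M: "0 < dim_row M" "0 < dim_col M"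
    and k: "1 \<le> k" "32 * k * 8 ^ k \<le> K"
    and no: "\<not> corner_minor k E"
    and r: "labelling r" and c: "labelling c" and low: "low_mixed_values K E r c"
  shows "(good_step M (2 * K * card A ^ Suc K))\<^sup>*\<^sup>* (label_partition M r c) ({{..<dim_row M}}, {{..<dim_col M}})"
  using r c low
proof (induction "r (dim_row M - 1) + c (dim_col M - 1)" arbitrary: r c rule: less_induct)
  case less
  let ?B = "2 * K * card A ^ Suc K"
  define n where "n = dim_row M"
  define m where "m = dim_col M"
  note r = less.prems(1) and c = less.prems(2) and low = less.prems(3)
  have mr: "mono r" and mc: "mono c" using r c by (simp_all add: labelling_mono)
  have E: "Suc x < n \<and> Suc y < m" if "(x, y) \<in> E" for x y
    using that unfolding E_def corners_def n_def m_def by auto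
  have ref: "refines {..<n} (fst (label_partition M r c)) (fst (label_partition M (g \<circ> r) (h \<circ> c)))"
    "refines {..<m} (snd (label_partition M r c)) (snd (label_partition M (g \<circ> r) (h \<circ> c)))" for g h
    unfolding label_partition_def n_def m_def
    by (simp_all add: refines_quotient equiv_row_equiv row_equiv_comp)
  show ?case
  proof (cases "r (n - 1) + c (m - 1) = 0")
    \<comment> \<open>One label is left on each side, but its classes still have to be merged. At
      most 2 \<alpha>^(K+1) parts remain on each side, by \<open>card_parts_in_label\<close> with
      \<open>h = id\<close>, so every order of merges stays within the bound, as 1 \<le> K.\<close>
    case True
    have el: "M $$ (x, y) \<in> A" if "x < n" "y < m" for x y
      using that A(3) elements_matI[of M n m x y] unfolding n_def m_def by auto
    have el': "M $$ (y, x) \<in> A" if "x < m" "y < n" for x y using el that by blast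
    have r0: "r x = 0" if "x < n" for x using monoD[OF mr, of x "n - 1"] that True by simp
    have c0: "c y = 0" if "y < m" for y using monoD[OF mc, of y "m - 1"] that True by simp
    have triv: "refines {..<l} P {{..<l}}" if "partition_on {..<l} P" "0 < l" for P and l :: nat
    proof -
      have "{..<l} \<noteq> {}" using that(2) by blast
      then have "partition_on {..<l} {{..<l}}" by (rule partition_on_space)
      moreover have "X \<subseteq> {..<l}" if "X \<in> P" for X
        using that unfolding partition_onD1[OF \<open>partition_on {..<l} P\<close>] by (rule Union_upper)
      ultimately show ?thesis using that(1) unfolding refines_def by simp
    qed
    have "1 * 1 * 1 \<le> 32 * k * 8 ^ k" using k(1) by (intro mult_le_mono) auto
    then have "1 \<le> K" using k(2) by linarith
    have parts: "partition_on {..<n} (fst (label_partition M r c))"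
      "partition_on {..<m} (snd (label_partition M r c))"
      using ref[of id id] unfolding refines_def by (simp_all only:)
    have B: "2 * card A ^ Suc K \<le> ?B" using \<open>1 \<le> K\<close> by simp
    have "(good_step M ?B)\<^sup>*\<^sup>* (fst (label_partition M r c), snd (label_partition M r c)) ({{..<n}}, {{..<m}})"
      unfolding n_def m_def
    proof (rule good_path_between, fold n_def m_def)
      show "refines {..<n} (fst (label_partition M r c)) {{..<n}}"
        "refines {..<m} (snd (label_partition M r c)) {{..<m}}"
        using triv[OF parts(1)] triv[OF parts(2)] M by (simp_all add: n_def m_def)
    next
      fix U V
      assume U: "refines {..<n} (fst (label_partition M r c)) U" and V: "refines {..<m} (snd (label_partition M r c)) V"
      have part: "mat_partition M (U, V)" using U V unfolding mat_partition_def refines_def n_def m_def by auto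
      have low': "mixed_value E r c i \<le> K" "mixed_value (E\<inverse>) c r i \<le> K" for i
        using low unfolding low_mixed_values_def by auto
      have "card {Y \<in> V. Y \<subseteq> {y. id (c y) = 0}} \<le> 2 * card A ^ Suc K"
        by (rule card_parts_in_label[where n = n and m = m and f = "entry M", OF A(1,2) el mr mc])
          (use low' V in \<open>simp_all add: label_partition_def E_def n_def m_def\<close>)
      then have cV: "card V \<le> 2 * card A ^ Suc K"
        using parts_in_zero_label[OF c0 V] by simp
      have "card {X \<in> U. X \<subseteq> {x. id (r x) = 0}} \<le> 2 * card A ^ Suc K"
        by (rule card_parts_in_label[where n = m and m = n and f = "\<lambda>x y. M $$ (y, x)", OF A(1,2) el' mc mr])
          (use low' U in \<open>simp_all add: label_partition_def E_def n_def m_def corners_converse\<close>)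
      then have cU: "card U \<le> 2 * card A ^ Suc K"
        using parts_in_zero_label[OF r0 U] by simp
      have "finite U" "finite V" using U V unfolding refines_def
        by (metis finite_UnionD finite_lessThan partition_onD1)+
      have "card {X \<in> W. P X} \<le> ?B" if "finite W" "card W \<le> 2 * card A ^ Suc K" for P and W :: "nat set set"
      proof -
        have "card {X \<in> W. P X} \<le> card W" using that(1) by (intro card_mono) auto
        then show ?thesis using that(2) B by (rule order_trans[OF _ order_trans])
      qed
      note this[OF \<open>finite U\<close> cU] this[OF \<open>finite V\<close> cV]
      then show "good_partition M ?B (U, V)"
        unfolding good_partition_def using part error_value_le_iff[OF part M(1)] by simp
    qed
    then show ?thesis unfolding n_def m_def by simp
  next
    case False
    \<comment> \<open>This serves a row merge with \<open>h = id\<close> and a column merge with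
      \<open>g = id\<close>.\<close>
    have main: "(good_step M ?B)\<^sup>*\<^sup>* (label_partition M r c) ({{..<dim_row M}}, {{..<dim_col M}})"
      if low': "low_mixed_values K E (g \<circ> r) (h \<circ> c)"
        and lab: "labelling (g \<circ> r)" "labelling (h \<circ> c)"
        and g: "\<And>j. j = g j \<or> j = Suc (g j)" and h: "\<And>j. j = h j \<or> j = Suc (h j)"
        and less': "(g \<circ> r) (n - 1) + (h \<circ> c) (m - 1) < r (n - 1) + c (m - 1)" for g h
    proof -
      have "(good_step M ?B)\<^sup>*\<^sup>* (fst (label_partition M r c), snd (label_partition M r c))
          (fst (label_partition M (g \<circ> r) (h \<circ> c)), snd (label_partition M (g \<circ> r) (h \<circ> c)))"
      proof (rule good_path_between[OF ref[unfolded n_def m_def]])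
        fix U V
        assume UV: "refines {..<dim_row M} (fst (label_partition M r c)) U"
          "refines {..<dim_row M} U (fst (label_partition M (g \<circ> r) (h \<circ> c)))"
          "refines {..<dim_col M} (snd (label_partition M r c)) V"
          "refines {..<dim_col M} V (snd (label_partition M (g \<circ> r) (h \<circ> c)))"
        show "good_partition M ?B (U, V)"
          by (rule good_partition_between[where g = g and h = h, OF A M(1) mr mc low[unfolded E_def]
                low'[unfolded E_def] g h UV])
      qed
      then have "(good_step M ?B)\<^sup>*\<^sup>* (label_partition M r c) (label_partition M (g \<circ> r) (h \<circ> c))"
        by simp
      then show ?thesis
        using less.hyps[OF less'[unfolded n_def m_def] lab low'] by (rule rtranclp_trans)
    qed
    have merge: "j = merge_at i j \<or> j = Suc (merge_at i j)" for i j unfolding merge_at_def by auto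
    have "0 < r (n - 1) + c (m - 1)" using False by simp
    then have "(\<exists>i < r (n - 1). low_mixed_values K E (merge_at i \<circ> r) c) \<or>
        (\<exists>j < c (m - 1). low_mixed_values K E r (merge_at j \<circ> c))"
      by (intro exists_merge[OF r c _ k no low]) (use E in auto)
    then show ?thesis
    proof (elim disjE exE conjE)
      fix i assume i: "i < r (n - 1)" "low_mixed_values K E (merge_at i \<circ> r) c"
      then have "merge_at i (r (n - 1)) < r (n - 1)" unfolding merge_at_def by auto
      then show ?thesis
        using main[of "merge_at i" id] i merge labelling_merge_at[OF r] c by simp
    next
      fix i assume i: "i < c (m - 1)" "low_mixed_values K E r (merge_at i \<circ> c)"
      then have "merge_at i (c (m - 1)) < c (m - 1)" unfolding merge_at_def by auto
      then show ?thesis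
        using main[of id "merge_at i"] i merge labelling_merge_at[OF c] r by simp
    qed
  qed
qed

lemma label_partition_id:
  "label_partition M id id = ((\<lambda>i. {i}) ` {..<dim_row M}, (\<lambda>j. {j}) ` {..<dim_col M})"
proof -
  have "row_equiv f n m id id = Id_on {..<n}" for f :: "nat \<Rightarrow> nat \<Rightarrow> 'a" and n m
    unfolding row_equiv_def by auto
  moreover have "{..<n} // Id_on {..<n} = (\<lambda>i. {i}) ` {..<n}" for n :: nat
    unfolding quotient_def by auto
  ultimately show ?thesis unfolding label_partition_def by simp
qed

text \<open>A part consisting of one row or one column has no room for a 2 x 2 square; the greedy
  process may start at the singletons.\<close>

lemma low_mixed_values_id: "low_mixed_values K E id id"
  unfolding low_mixed_values_def mixed_value_def by simp

lemma rtranclp_list: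
  assumes "R\<^sup>*\<^sup>* a b"
  shows "\<exists>xs. xs \<noteq> [] \<and> hd xs = a \<and> last xs = b \<and> (\<forall>i. Suc i < length xs \<longrightarrow> R (xs ! i) (xs ! Suc i))"
  using assms
proof (induction rule: rtranclp_induct)
  case base
  then show ?case by (intro exI[of _ "[a]"]) simp
next
  case (step y z)
  then obtain xs where xs: "xs \<noteq> []" "hd xs = a" "last xs = y"
    "\<forall>i. Suc i < length xs \<longrightarrow> R (xs ! i) (xs ! Suc i)" by blast
  show ?case
  proof (intro exI[of _ "xs @ [z]"] conjI allI impI)
    fix i assume i: "Suc i < length (xs @ [z])"
    show "R ((xs @ [z]) ! i) ((xs @ [z]) ! Suc i)"
    proof (cases "Suc i < length xs")
      case False
      then have "Suc i = length xs" using i by simp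
      then have "i = length xs - 1" "i < length xs" by simp_all
      then have "xs ! i = y" using xs(1,3) by (simp add: last_conv_nth)
      then show ?thesis using step.hyps(2) \<open>Suc i = length xs\<close> \<open>i < length xs\<close> by (simp add: nth_append)
    qed (use xs(4) in \<open>simp add: nth_append\<close>)
  qed (use xs in auto)
qed

lemma card_contraction_step:
  assumes "contraction_step P Q" "mat_partition M P"
  shows "Suc (card (fst Q) + card (snd Q)) = card (fst P) + card (snd P)"
proof -
  have "Suc (card Q') = card P'" if "merge_two P' Q'" "partition_on {..<n} P'" for P' Q' and n :: nat
    using that partition_on_merge(2)[OF that(2)] unfolding merge_two_def by auto
  then show ?thesis using assms unfolding contraction_step_def mat_partition_def by fastforce
qed

lemma contraction_sequence_of_path:
  fixes M :: "'a mat"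
  assumes M: "0 < dim_row M" "0 < dim_col M"
  defines "S \<equiv> ((\<lambda>i. {i}) ` {..<dim_row M}, (\<lambda>j. {j}) ` {..<dim_col M})"
  assumes path: "(good_step M B)\<^sup>*\<^sup>* S ({{..<dim_row M}}, {{..<dim_col M}})"
  shows "\<exists>Ps. contraction_sequence M Ps \<and> (\<forall>P\<in>set Ps. error_value M P \<le> B)"
proof -
  obtain Ps where Ps: "Ps \<noteq> []" "hd Ps = S" "last Ps = ({{..<dim_row M}}, {{..<dim_col M}})"
    and step: "\<And>i. Suc i < length Ps \<Longrightarrow> good_step M B (Ps ! i) (Ps ! Suc i)"
    using rtranclp_list[OF path] by blast
  have part: "mat_partition M S" unfolding S_def mat_partition_def by (simp add: partition_on_singletons)
  have e: "{Y \<in> (\<lambda>j. {j}) ` C. nonconstant_on (entry M) {x} Y} = {}"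
    "{X \<in> (\<lambda>i. {i}) ` C. nonconstant_on (entry M) X {x}} = {}" for C x
    by (auto simp: nonconstant_on_def)
  have "error_value M S \<le> B"
    using part unfolding S_def by (subst error_value_le_iff) (simp_all add: M e)
  then have "good_partition M B S" unfolding good_partition_def using part by simp
  then have good: "good_partition M B (Ps ! i)" if "i < length Ps" for i
    using that step[of "i - 1"] Ps(1,2) by (cases i) (auto simp: hd_conv_nth)
  \<comment> \<open>Each step loses exactly one part; as the last partition has two parts in all,
    this fixes the length of the sequence.\<close>
  have count: "card (fst (Ps ! i)) + card (snd (Ps ! i)) + i = dim_row M + dim_col M" if "i < length Ps" for i
    using that
  proof (induction i)
    case 0
    have "card ((\<lambda>i. {i}) ` {..<n}) = n" for n :: nat by (subst card_image) auto
    then show ?case using Ps(1,2) unfolding S_def by (simp add: hd_conv_nth[symmetric])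
  next
    case (Suc i)
    then show ?case
      using card_contraction_step[of "Ps ! i" "Ps ! Suc i" M] step[of i] good[of i]
      unfolding good_partition_def by simp
  qed
  have "length Ps = dim_row M + dim_col M - 1"
    using count[of "length Ps - 1"] Ps(1,3) by (simp add: last_conv_nth)
  moreover have "mat_partition M P \<and> error_value M P \<le> B" if "P \<in> set Ps" for P
    using that good unfolding good_partition_def by (auto simp: in_set_conv_nth)
  ultimately have "contraction_sequence M Ps \<and> (\<forall>P\<in>set Ps. error_value M P \<le> B)"
    unfolding contraction_sequence_def using Ps step S_def by simp
  then show ?thesis by blast
qed

lemma twin_width_mixed_free:
  assumes A: "finite A" "A \<noteq> {}" "elements_mat M \<subseteq> A" and M: "0 < dim_row M" "0 < dim_col M"
    and k: "1 \<le> k" "32 * k * 8 ^ k \<le> K" and free: "mixed_free k M"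
  shows "twin_width M \<le> 2 * K * card A ^ Suc K"
proof -
  have no: "\<not> corner_minor k (corners (entry M) (dim_row M) (dim_col M))"
    using free mixed_minor_of_corner_minor k(1) unfolding mixed_free_def by blast
  have "labelling id" unfolding labelling_def by simp
  then have "\<exists>Ps. contraction_sequence M Ps \<and> (\<forall>P\<in>set Ps. error_value M P \<le> 2 * K * card A ^ Suc K)"
    using contraction_path[OF A M k no _ _ low_mixed_values_id]
    by (intro contraction_sequence_of_path[OF M]) (simp add: label_partition_id)
  then show ?thesis unfolding twin_width_def by (rule Least_le)
qed

section \<open>Mixed freeness of twin-ordered matrices\<close>

text \<open>An interval that meets \<open>{a..<b}\<close> without lying inside sticks out on one
  side, so it contains \<open>a\<close> or \<open>b - 1\<close>. Disjointness leaves one interval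
  for each of these points.\<close>

lemma meeting_parts_le_two:
  assumes int: "\<And>C. C \<in> CS \<Longrightarrow> \<exists>a b. C = {a..<b :: nat}" and dis: "disjoint CS"
    and no: "\<And>C. C \<in> CS \<Longrightarrow> \<not> C \<subseteq> {a..<b}"
  shows "finite {C \<in> CS. C \<inter> {a..<b} \<noteq> {}}" "card {C \<in> CS. C \<inter> {a..<b} \<noteq> {}} \<le> 2"
proof -
  have "\<exists>\<phi>. inj_on \<phi> {C \<in> CS. C \<inter> {a..<b} \<noteq> {}} \<and> \<phi> ` {C \<in> CS. C \<inter> {a..<b} \<noteq> {}} \<subseteq> {a, b - 1}"
  proof (intro exI conjI)
    let ?\<phi> = "\<lambda>C. if a \<in> C then a else b - 1"
    have mem: "?\<phi> C \<in> C" if "C \<in> CS" "C \<inter> {a..<b} \<noteq> {}" for C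
    proof -
      have "\<exists>u v. C = {u..<v}" using int[OF that(1)] .
      then obtain u v where uv: "C = {u..<v}" by blast
      have "\<exists>z. u \<le> z \<and> z < v \<and> a \<le> z \<and> z < b" using that(2) unfolding uv by (intro exI[of _ "max u a"]) auto
      moreover have "\<not> (a \<le> u \<and> v \<le> b)" using no[OF that(1)] uv by auto
      ultimately show ?thesis unfolding uv by auto
    qed
    show "inj_on ?\<phi> {C \<in> CS. C \<inter> {a..<b} \<noteq> {}}"
    proof (rule inj_onI)
      fix C D assume CD: "C \<in> {C \<in> CS. C \<inter> {a..<b} \<noteq> {}}" "D \<in> {C \<in> CS. C \<inter> {a..<b} \<noteq> {}}" "?\<phi> C = ?\<phi> D"
      then have "?\<phi> C \<in> C \<inter> D" using mem[of C] mem[of D] by simp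
      then show "C = D" using CD disjointD[OF dis, of C D] by blast
    qed
    show "?\<phi> ` {C \<in> CS. C \<inter> {a..<b} \<noteq> {}} \<subseteq> {a, b - 1}" by auto
  qed
  then obtain \<phi> where \<phi>: "inj_on \<phi> {C \<in> CS. C \<inter> {a..<b} \<noteq> {}}"
    "\<phi> ` {C \<in> CS. C \<inter> {a..<b} \<noteq> {}} \<subseteq> {a, b - 1}" by blast
  show "finite {C \<in> CS. C \<inter> {a..<b} \<noteq> {}}" 
    by (rule inj_on_finite[OF \<phi>]) simp
  have "card {C \<in> CS. C \<inter> {a..<b} \<noteq> {}} \<le> card {a, b - 1}"
    using \<phi> by (intro card_inj_on_le) auto
  also have "\<dots> \<le> 2" by (simp add: card_insert_if)
  finally show "card {C \<in> CS. C \<inter> {a..<b} \<noteq> {}} \<le> 2" .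
qed

text \<open>Each part of \<open>CS\<close> has a column that is not constant on \<open>X\<close>,
  and is charged to the part of \<open>T\<close> containing that column. That part is nonconstant,
  and it is charged at most twice.\<close>

lemma card_nonconstant_parts:
  assumes T: "partition_on {..<m} T" "\<And>Y. Y \<in> T \<Longrightarrow> \<exists>a b. Y = {a..<b}"
    and CS: "partition_on {..<m} CS" "\<And>C. C \<in> CS \<Longrightarrow> \<exists>a b. C = {a..<b :: nat}"
    and no: "\<And>C Y. C \<in> CS \<Longrightarrow> Y \<in> T \<Longrightarrow> \<not> C \<subseteq> Y"
    and nc: "\<And>C. C \<in> CS \<Longrightarrow> \<exists>y\<in>C. \<exists>x\<in>X. \<exists>x'\<in>X. f x y \<noteq> f x' y"
  shows "card CS \<le> 2 * card {Y \<in> T. nonconstant_on f X Y}"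
proof -
  define Z where "Z = {Y \<in> T. nonconstant_on f X Y}"
  have "finite T" using T by (metis finite_UnionD finite_lessThan partition_onD1)
  then have "finite Z" unfolding Z_def by simp
  have fin: "finite {C \<in> CS. C \<inter> Y \<noteq> {}}" and two: "card {C \<in> CS. C \<inter> Y \<noteq> {}} \<le> 2" if "Y \<in> Z" for Y
  proof -
    have "Y \<in> T" using that unfolding Z_def by simp
    then obtain a b where "Y = {a..<b}" using T(2) by blast
    then show "finite {C \<in> CS. C \<inter> Y \<noteq> {}}" "card {C \<in> CS. C \<inter> Y \<noteq> {}} \<le> 2"
      using meeting_parts_le_two[of CS a b] CS partition_onD2[OF CS(1)] no[OF _ \<open>Y \<in> T\<close>] by simp_all
  qed
  have "CS \<subseteq> (\<Union>Y\<in>Z. {C \<in> CS. C \<inter> Y \<noteq> {}})"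
  proof
    fix C assume C: "C \<in> CS"
    then obtain y x x' where y: "y \<in> C" "x \<in> X" "x' \<in> X" "f x y \<noteq> f x' y" using nc by blast
    then have "y \<in> {..<m}" using C partition_onD1[OF CS(1)] by blast
    then obtain Y where "Y \<in> T" "y \<in> Y" using partition_onD1[OF T(1)] by blast
    then have "Y \<in> Z" unfolding Z_def nonconstant_on_def using y by blast
    then show "C \<in> (\<Union>Y\<in>Z. {C \<in> CS. C \<inter> Y \<noteq> {}})" using C y \<open>y \<in> Y\<close> by blast
  qed
  then have "card CS \<le> card (\<Union>Y\<in>Z. {C \<in> CS. C \<inter> Y \<noteq> {}})"
    using \<open>finite Z\<close> fin by (intro card_mono) auto
  also have "\<dots> \<le> (\<Sum>Y\<in>Z. card {C \<in> CS. C \<inter> Y \<noteq> {}})" using \<open>finite Z\<close> by (rule card_UN_le)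
  also have "\<dots> \<le> (\<Sum>Y\<in>Z. 2)" using two by (rule sum_mono)
  finally show ?thesis unfolding Z_def by simp
qed

text \<open>Containing a row part of the minor and containing a column part of it are equivalent for
  each partition of the sequence, since one without the other would give 2 t + 2 \<le> 2 t. A
  contraction changes one side only, so neither can ever begin, yet the final row part contains all
  rows.\<close>

lemma mixed_free_twin_ordered:
  assumes M: "0 < dim_row M" "0 < dim_col M" and ordered: "twin_ordered t M"
  shows "mixed_free (2 * t + 2) M"
  unfolding mixed_free_def
proof
  assume "\<exists>P. mixed_minor (2 * t + 2) M P"
  then obtain RS CS where minor: "mixed_minor (2 * t + 2) M (RS, CS)" by auto
  have RS: "partition_on {..<dim_row M} RS" "card RS = 2 * t + 2" "\<And>X. X \<in> RS \<Longrightarrow> \<exists>a b. X = {a..<b}"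
    and CS: "partition_on {..<dim_col M} CS" "card CS = 2 * t + 2" "\<And>Y. Y \<in> CS \<Longrightarrow> \<exists>a b. Y = {a..<b}"
    and mixed: "\<And>X Y. X \<in> RS \<Longrightarrow> Y \<in> CS \<Longrightarrow> mixed_mat (submatrix M X Y)"
    using minor unfolding mixed_minor_def kl_division_def mat_division_def mat_partition_def by auto
  have sub: "X \<subseteq> {..<dim_row M}" "Y \<subseteq> {..<dim_col M}" if "X \<in> RS" "Y \<in> CS" for X Y
    using that unfolding partition_onD1[OF RS(1)] partition_onD1[OF CS(1)] by (simp_all add: Union_upper)
  have vert: "\<exists>y\<in>Y. \<exists>x\<in>X. \<exists>x'\<in>X. M $$ (x, y) \<noteq> M $$ (x', y)"
    and hor: "\<exists>x\<in>X. \<exists>y\<in>Y. \<exists>y'\<in>Y. M $$ (x, y) \<noteq> M $$ (x, y')" if "X \<in> RS" "Y \<in> CS" for X Y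
    using mixed[OF that] not_vertical_submatrix[OF sub[OF that]] not_horizontal_submatrix[OF sub[OF that]]
    unfolding mixed_mat_def by blast+
  have "RS \<noteq> {}" "CS \<noteq> {}" using RS(2) CS(2) by auto
  obtain Ps where Ps: "contraction_sequence M Ps"
    and div: "\<And>P. P \<in> set Ps \<Longrightarrow> mat_division M P \<and> error_value M P \<le> t"
    using ordered unfolding twin_ordered_def by blast
  have step: "\<And>i. Suc i < length Ps \<Longrightarrow> contraction_step (Ps ! i) (Ps ! Suc i)"
    and ne: "Ps \<noteq> []" and hd: "hd Ps = ((\<lambda>i. {i}) ` {..<dim_row M}, (\<lambda>j. {j}) ` {..<dim_col M})"
    and last: "card (fst (last Ps)) = 1"
    using Ps unfolding contraction_sequence_def by auto
  define rowhit where "rowhit P \<longleftrightarrow> (\<exists>X\<in>fst P. \<exists>X'\<in>RS. X' \<subseteq> X)" for P :: mat_part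
  define colhit where "colhit P \<longleftrightarrow> (\<exists>Y\<in>snd P. \<exists>Y'\<in>CS. Y' \<subseteq> Y)" for P :: mat_part
  have P: "partition_on {..<dim_row M} (fst P)" "partition_on {..<dim_col M} (snd P)"
    "\<And>X. X \<in> fst P \<Longrightarrow> \<exists>a b. X = {a..<b}" "\<And>X. X \<in> snd P \<Longrightarrow> \<exists>a b. X = {a..<b}" if "P \<in> set Ps" for P
    using div[OF that] unfolding mat_division_def mat_partition_def by auto
  have err: "card {Y \<in> snd P. nonconstant_on (entry M) X Y} \<le> t" if "P \<in> set Ps" "X \<in> fst P" for P X
    using div[OF that(1)] that(2) error_value_le_iff[of M "fst P" "snd P" t] M
    unfolding mat_division_def by simp
  have err': "card {X \<in> fst P. nonconstant_on (entry M) X Y} \<le> t" if "P \<in> set Ps" "Y \<in> snd P" for P Y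
    using div[OF that(1)] that(2) error_value_le_iff[of M "fst P" "snd P" t] M
    unfolding mat_division_def by simp
  have colhit: "colhit P" if mem: "P \<in> set Ps" and hit: "rowhit P" for P
  proof (rule ccontr)
    assume "\<not> colhit P"
    obtain X X' where X: "X \<in> fst P" "X' \<in> RS" "X' \<subseteq> X" using hit unfolding rowhit_def by blast
    have "card CS \<le> 2 * card {Y \<in> snd P. nonconstant_on (entry M) X Y}"
    proof (rule card_nonconstant_parts[OF P(2)[OF that(1)] P(4)[OF that(1)] CS(1,3)])
      show "\<exists>y\<in>C. \<exists>x\<in>X. \<exists>x'\<in>X. M $$ (x, y) \<noteq> M $$ (x', y)" if "C \<in> CS" for C
        using vert[OF X(2) that] X(3) by blast
    qed (use \<open>\<not> colhit P\<close> in \<open>auto simp: colhit_def\<close>)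
    then show False using err[OF that(1) X(1)] CS(2) by simp
  qed
  have rowhit: "rowhit P" if mem: "P \<in> set Ps" and hit: "colhit P" for P
  proof (rule ccontr)
    assume "\<not> rowhit P"
    obtain Y Y' where Y: "Y \<in> snd P" "Y' \<in> CS" "Y' \<subseteq> Y" using hit unfolding colhit_def by blast
    have "card RS \<le> 2 * card {X \<in> fst P. nonconstant_on (\<lambda>x y. M $$ (y, x)) Y X}"
    proof (rule card_nonconstant_parts[OF P(1)[OF that(1)] P(3)[OF that(1)] RS(1,3)])
      show "\<exists>y\<in>C. \<exists>x\<in>Y. \<exists>x'\<in>Y. M $$ (y, x) \<noteq> M $$ (y, x')" if "C \<in> RS" for C
        using hor[OF that Y(2)] Y(3) by blast
    qed (use \<open>\<not> rowhit P\<close> in \<open>auto simp: rowhit_def\<close>)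
    then show False
      using err'[OF that(1) Y(1)] RS(2) nonconstant_on_swap[of "entry M"] by simp
  qed
  have "\<not> rowhit (Ps ! i)" if "i < length Ps" for i
    using that
  proof (induction i)
    case 0
    \<comment> \<open>A mixed zone has two distinct rows, so no row part of the minor fits into a
      singleton.\<close>
    show ?case
    proof
      assume "rowhit (Ps ! 0)"
      then obtain x X' where "X' \<in> RS" "X' \<subseteq> {x}" using hd ne unfolding rowhit_def by (auto simp: hd_conv_nth)
      moreover obtain Y where "Y \<in> CS" using \<open>CS \<noteq> {}\<close> by blast
      ultimately show False using vert[of X' Y] by blast
    qed
  next
    case (Suc i)
    have mem: "Ps ! i \<in> set Ps" "Ps ! Suc i \<in> set Ps" using Suc.prems by auto
    have "\<not> rowhit (Ps ! i)" using Suc by simp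
    then have "\<not> colhit (Ps ! i)" using rowhit mem by blast
    have "fst (Ps ! Suc i) = fst (Ps ! i) \<or> snd (Ps ! Suc i) = snd (Ps ! i)"
      using step[OF Suc.prems] unfolding contraction_step_def by auto
    then have "\<not> rowhit (Ps ! Suc i) \<or> \<not> colhit (Ps ! Suc i)"
      using \<open>\<not> rowhit (Ps ! i)\<close> \<open>\<not> colhit (Ps ! i)\<close> unfolding rowhit_def colhit_def by metis
    then show ?case using colhit mem by blast
  qed
  then have "\<not> rowhit (last Ps)" using ne by (simp add: last_conv_nth)
  moreover have "rowhit (last Ps)"
  proof -
    obtain X where X: "fst (last Ps) = {X}" using last by (meson card_1_singletonE)
    then have "X = {..<dim_row M}" using P(1)[of "last Ps"] ne partition_onD1 by fastforce
    moreover obtain X' where "X' \<in> RS" using \<open>RS \<noteq> {}\<close> by blast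
    ultimately show ?thesis unfolding rowhit_def using X sub(1) \<open>CS \<noteq> {}\<close> by blast
  qed
  ultimately show False by blast
qed

section \<open>Size of the constants\<close>

text \<open>After division by 16/3 and by 8^k the claim becomes 6 k \<le> (k + 1)^2 2^k.\<close>

lemma c_const_ge: "32 * real k * 8 ^ k \<le> 2 * c_const k"
proof -
  have "(16::real) ^ k = 2 ^ k * 8 ^ k" by (simp flip: power_mult_distrib)
  moreover have "(2::real) ^ (4 * k) = 16 ^ k" by (simp add: power_mult)
  moreover have "6 * real k \<le> (real k + 1)\<^sup>2 * 2 ^ k"
  proof (cases "k = 0")
    case False
    then have "(2::real) \<le> 2 ^ k" by (simp add: self_le_power)
    moreover have "3 * real k \<le> (real k + 1)\<^sup>2" using sum_squares_bound[of "real k" 1] by (simp add: power2_eq_square algebra_simps)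
    ultimately have "(3 * real k) * 2 \<le> (real k + 1)\<^sup>2 * 2 ^ k" by (intro mult_mono) auto
    then show ?thesis by simp
  qed simp
  then have "(6 * real k) * 8 ^ k \<le> ((real k + 1)\<^sup>2 * 2 ^ k) * 8 ^ k" by (intro mult_right_mono) auto
  ultimately show ?thesis unfolding c_const_def by (simp add: mult_ac)
qed

lemma c_const_bounds: "8 / 3 \<le> c_const t" "c_const t \<le> 4 * 2 ^ (6 * t)"
proof -
  have "1 \<le> (real t + 1)\<^sup>2" "(1::real) \<le> 2 ^ (4 * t)" by (simp_all add: power2_eq_square algebra_simps)
  then have "1 * 1 \<le> (real t + 1)\<^sup>2 * 2 ^ (4 * t)" by (intro mult_mono) auto
  then show "8 / 3 \<le> c_const t" unfolding c_const_def by simp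
  have "t + 1 \<le> 2 ^ t" by (induction t) auto
  then have "real (t + 1) \<le> real (2 ^ t)" by (simp only: of_nat_le_iff)
  then have "real t + 1 \<le> 2 ^ t" by simp
  then have "(real t + 1)\<^sup>2 \<le> (2 ^ t)\<^sup>2" by (intro power_mono) auto
  then have "8 / 3 * (real t + 1)\<^sup>2 * 2 ^ (4 * t) \<le> 4 * (2 ^ t)\<^sup>2 * 2 ^ (4 * t)" by (intro mult_right_mono mult_mono) auto
  also have "\<dots> = 4 * 2 ^ (6 * t)" by (simp flip: power_mult power_add)
  finally show "c_const t \<le> 4 * 2 ^ (6 * t)" unfolding c_const_def .
qed

lemma twin_width_bound:
  assumes A: "finite A" "A \<noteq> {}" "elements_mat M \<subseteq> A" and M: "0 < dim_row M" "0 < dim_col M"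
    and t: "1 \<le> t" and free: "mixed_free t M"
  shows "real (twin_width M) \<le> 4 * c_const t * real (card A) powr (4 * c_const t + 2)"
proof -
  \<comment> \<open>Rounding down is harmless, since \<open>32 * t * 8 ^ t\<close> is itself a
    natural number below 2 c_t.\<close>
  define K where "K = nat \<lfloor>2 * c_const t\<rfloor>"
  have c: "0 < c_const t" using c_const_bounds(1)[of t] by linarith
  have "real (32 * t * 8 ^ t) \<le> 2 * c_const t" using c_const_ge[of t] by simp
  then have K: "32 * t * 8 ^ t \<le> K" unfolding K_def by (simp add: le_nat_floor)
  have Kc: "real K \<le> 2 * c_const t" unfolding K_def using c by (simp add: of_nat_floor)
  have "card A > 0" using A by (simp add: card_gt_0_iff)
  then have \<alpha>: "1 \<le> real (card A)" by simp
  have "real (twin_width M) \<le> real (2 * K * card A ^ Suc K)"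
    using twin_width_mixed_free[OF A M t K free] by (simp only: of_nat_le_iff)
  also have "\<dots> = 2 * real K * real (card A) powr (real (Suc K))"
    using \<alpha> by (subst powr_realpow) auto
  also have "\<dots> \<le> (4 * c_const t) * real (card A) powr (4 * c_const t + 2)"
  proof (rule mult_mono)
    show "real (card A) powr real (Suc K) \<le> real (card A) powr (4 * c_const t + 2)"
      using Kc c \<alpha> by (intro powr_mono) auto
  qed (use Kc c in auto)
  finally show ?thesis .
qed

lemma log2_le:
  assumes "0 < (x :: real)"
  shows "log 2 x \<le> x"
proof -
  \<comment> \<open>The tangent of \<open>ln\<close> at 2 gives ln x \<le> x / 2, and ln 2 \<ge> 1/2
    turns this into the claim; the tangent at 1 would be too weak because ln 2 < 1.\<close>
  have "ln (x / 2) \<le> x / 2 - 1" using assms by (intro ln_le_minus_one) simp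
  then have "ln x \<le> x / 2 - 1 + ln 2" using assms by (simp add: ln_div)
  moreover have "ln (2::real) \<le> 1" using ln_le_minus_one[of 2] by simp
  ultimately have "ln x \<le> x * (1 / 2)" by simp
  also have "\<dots> \<le> x * ln 2"
    using ln_le_minus_one[of "1 / 2"] assms by (intro mult_left_mono) (simp_all add: ln_div)
  finally show ?thesis by (simp add: log_def pos_divide_le_eq)
qed

text \<open>The alphabet is fixed, so \<open>L\<close> enters only the constant hidden in
  O(t).\<close>

lemma bound_doubly_exponential:
  assumes "1 \<le> \<alpha>"
  shows "\<exists>g :: nat \<Rightarrow> real. g \<in> O(\<lambda>t. real t) \<and>
    (\<forall>t. 4 * c_const t * real \<alpha> powr (4 * c_const t + 2) = 2 powr (2 powr g t))"
proof -
  define b where "b t = 4 * c_const t * real \<alpha> powr (4 * c_const t + 2)" for t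
  define L where "L = log 2 (real \<alpha>)"
  define g where "g t = log 2 (log 2 (b t))" for t
  have \<alpha>: "1 \<le> real \<alpha>" using assms by simp
  have "0 \<le> L" unfolding L_def using \<alpha> by simp
  have c: "8 / 3 \<le> c_const t" for t by (rule c_const_bounds)
  have lb: "log 2 (b t) = log 2 (4 * c_const t) + (4 * c_const t + 2) * L" for t
    unfolding b_def L_def using c[of t] \<alpha> by (simp add: log_mult log_powr)
  \<comment> \<open>The factor 4 c_t alone achieves this, also for a one-letter alphabet with L = 0.
    It makes the iterated logarithm defined and nonnegative.\<close>
  have ge: "2 \<le> log 2 (b t)" for t
  proof -
    have "log 2 4 \<le> log 2 (4 * c_const t)" using c[of t] by (subst log_le_cancel_iff) auto
    moreover have "log 2 (4::real) = 2" using log_pow_cancel[of 2 2] by simp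
    moreover have "0 \<le> (4 * c_const t + 2) * L" using c[of t] \<open>0 \<le> L\<close> by simp
    ultimately show ?thesis unfolding lb by linarith
  qed
  have upper: "log 2 (b t) \<le> (18 * (1 + L)) * 2 ^ (6 * t)" for t
  proof -
    have "log 2 (4 * c_const t) \<le> 4 * c_const t"
      using c[of t] log2_le by simp
    then have "log 2 (b t) \<le> (4 * c_const t + 2) * (1 + L)" unfolding lb by (simp add: algebra_simps)
    also have "\<dots> \<le> (18 * 2 ^ (6 * t)) * (1 + L)"
    proof (rule mult_right_mono)
      have "(1::real) \<le> 2 ^ (6 * t)" by simp
      \<comment> \<open>Here 18 = 4 * 4 + 2, from c_t \<le> 4 * 2^(6 t).\<close>
      then show "4 * c_const t + 2 \<le> 18 * 2 ^ (6 * t)" using c_const_bounds(2)[of t] by linarith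
    qed (use \<open>0 \<le> L\<close> in simp)
    finally show ?thesis by (simp only: mult_ac)
  qed
  define G where "G = log 2 (18 * (1 + L))"
  have g: "0 \<le> g t" "g t \<le> G + 6 * real t" for t
  proof -
    show "0 \<le> g t" unfolding g_def using ge[of t] by simp
    have "g t \<le> log 2 ((18 * (1 + L)) * 2 ^ (6 * t))"
      unfolding g_def using ge[of t] upper[of t] \<open>0 \<le> L\<close> by (subst log_le_cancel_iff) auto
    also have "\<dots> = G + 6 * real t" unfolding G_def using \<open>0 \<le> L\<close> by (subst log_mult) (auto simp: log_nat_power)
    finally show "g t \<le> G + 6 * real t" .
  qed
  have "0 \<le> G" unfolding G_def using \<open>0 \<le> L\<close> by simp
  have "g \<in> O(\<lambda>t. real t)"
  proof (rule bigoI[where c = "G + 6"])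
    show "\<forall>\<^sub>F t in sequentially. norm (g t) \<le> (G + 6) * norm (real t)"
      using eventually_ge_at_top[of 1]
    proof eventually_elim
      case (elim t)
      then have "G * 1 \<le> G * real t" using \<open>0 \<le> G\<close> by (intro mult_left_mono) auto
      then show ?case using g[of t] by (simp add: algebra_simps)
    qed
  qed
  moreover have "b t = 2 powr (2 powr g t)" for t
  proof -
    have "0 < b t" unfolding b_def using c[of t] \<alpha> by (intro mult_pos_pos) auto
    moreover have "0 < log 2 (b t)" using ge[of t] by linarith
    ultimately show ?thesis unfolding g_def by (simp add: powr_log_cancel)
  qed
  ultimately show ?thesis unfolding b_def by blast
qed

theorem theorem5p4:
  fixes A :: "'a set" and \<alpha> :: nat
  assumes "finite A" and "A \<noteq> {}" and "card A = \<alpha>"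
  shows
    "(\<forall>(t::nat) (M::'a mat).
        0 < dim_row M \<longrightarrow> 0 < dim_col M \<longrightarrow> elements_mat M \<subseteq> A \<longrightarrow>
        twin_ordered t M \<longrightarrow> mixed_free (2 * t + 2) M) \<and>
     (\<forall>(t::nat) (M::'a mat).
        1 \<le> t \<longrightarrow> 0 < dim_row M \<longrightarrow> 0 < dim_col M \<longrightarrow> elements_mat M \<subseteq> A \<longrightarrow>
        mixed_free t M \<longrightarrow>
        real (twin_width M) \<le> 4 * c_const t * real \<alpha> powr (4 * c_const t + 2)) \<and>
     (\<exists>g :: nat \<Rightarrow> real. g \<in> O(\<lambda>t. real t) \<and>
        (\<forall>t. 4 * c_const t * real \<alpha> powr (4 * c_const t + 2) = 2 powr (2 powr g t)))"
proof (intro conjI allI impI)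
  have "1 \<le> \<alpha>" using assms by (metis One_nat_def Suc_leI card_gt_0_iff)
  then show "\<exists>g :: nat \<Rightarrow> real. g \<in> O(\<lambda>t. real t) \<and>
      (\<forall>t. 4 * c_const t * real \<alpha> powr (4 * c_const t + 2) = 2 powr (2 powr g t))"
    by (rule bound_doubly_exponential)
qed (use mixed_free_twin_ordered twin_width_bound[OF assms(1,2)] assms(3) in auto)

end
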